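(* Let $k\ge1$ and a constraint function $g:\{0,1\}^k\to\{0,1\}$ be given, with $p=\mathbb{E}[g(X)]$ for $X$ uniform on $\{0,1\}^k$, $P=\min\{p,1-p\}$ and $Q=1-P$. Then for all $c$ sufficiently large, $$\left(p\,c+\sqrt{PQ^2c/k}\right)n\;\lesssim\; f_g(n,cn)\;\lesssim\;\left(p\,c+\sqrt{2PQ\ln(2)\,c}\right)n.$$
   Context: A clause over $g$ on variables $X_1,\dots,X_n$ is given by an ordered $k$-tuple $(i_1,\dots,i_k)$ of distinct indices in $\{1,\dots,n\}$ and a sign vector $(\sigma_1,\dots,\sigma_k)\in\{0,1\}^k$; an assignment $x\in\{0,1\}^n$ satisfies it if $g(x_{i_1}\oplus\sigma_1,\dots,x_{i_k}\oplus\sigma_k)=1$ ($\oplus$ is addition mod 2). A random formula $F_g(n,m)$ consists of $m$ clauses chosen independently and uniformly at random (with replacement) from the $2^k n(n-1)\cdots(n-k+1)$ possible clauses. $\max F$ is the maximum over assignments of the number of satisfied clauses, and $f_g(n,m)=\mathbb{E}[\max F_g(n,m)]$; $cn$ means $\lfloor cn\rfloor$. Notation: $a(n)\lesssim b(n)$ means $\limsup_{n\to\infty}a(n)/b(n)\le1$; the limit in $n$ is taken first for fixed $c$, then $c$ large. *)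

theory Defs
  imports "HOL-Probability.Probability"
begin

text \<open>
  Elements of \<open>{0,1}\<close> are booleans, and addition modulo 2 is inequality. A \<open>k\<close>-ary constraint
  function is a function \<open>bool list \<Rightarrow> bool\<close> of which only the values on lists of length \<open>k\<close> are used.
\<close>

type_synonym clause = "nat list \<times> bool list"

definition cube :: "nat \<Rightarrow> bool list set" where
  "cube k = {xs. length xs = k}"

definition clauses :: "nat \<Rightarrow> nat \<Rightarrow> clause set" where
  "clauses k n = {is. length is = k \<and> distinct is \<and> set is \<subseteq> {1..n}} \<times> cube k"

definition assignments :: "nat \<Rightarrow> (nat \<Rightarrow> bool) set" where
  "assignments n = {1..n} \<rightarrow>\<^sub>E UNIV"

definition satisfies :: "(bool list \<Rightarrow> bool) \<Rightarrow> (nat \<Rightarrow> bool) \<Rightarrow> clause \<Rightarrow> bool" where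
  "satisfies g x C = (case C of (is, \<sigma>) \<Rightarrow> g (map2 (\<noteq>) (map x is) \<sigma>))"

definition num_sat :: "(bool list \<Rightarrow> bool) \<Rightarrow> (nat \<Rightarrow> bool) \<Rightarrow> clause list \<Rightarrow> nat" where
  "num_sat g x F = length (filter (satisfies g x) F)"

definition max_sat :: "(bool list \<Rightarrow> bool) \<Rightarrow> nat \<Rightarrow> clause list \<Rightarrow> nat" where
  "max_sat g n F = Max ((\<lambda>x. num_sat g x F) ` assignments n)"

text \<open>
  For \<open>n < k\<close> there are no clauses and the following distribution is meaningless (for \<open>m > 0\<close>);
  this has no influence on limits in \<open>n\<close>.
\<close>

definition random_formula :: "nat \<Rightarrow> nat \<Rightarrow> nat \<Rightarrow> clause list pmf" where
  "random_formula k n m = replicate_pmf m (pmf_of_set (clauses k n))"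

definition expected_max :: "nat \<Rightarrow> (bool list \<Rightarrow> bool) \<Rightarrow> nat \<Rightarrow> nat \<Rightarrow> real" where
  "expected_max k g n m =
     measure_pmf.expectation (random_formula k n m) (\<lambda>F. real (max_sat g n F))"

text \<open>
  The quotient is taken in the extended reals, where \<open>a / 0 = \<infinity>\<close> for \<open>a > 0\<close> and \<open>0 / 0 = 0\<close>.
  So a vanishing denominator cannot make the relation hold for a positive numerator, and
  the zero sequence is related to itself (this matters for \<open>g = 0\<close>).
\<close>

definition asymp_le :: "(nat \<Rightarrow> real) \<Rightarrow> (nat \<Rightarrow> real) \<Rightarrow> bool" where
  "asymp_le a b \<longleftrightarrow> limsup (\<lambda>n. ereal (a n) / ereal (b n)) \<le> 1"

end

theory Submission
  imports Defs "HOL-Real_Asymp.Real_Asymp"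
begin

text \<open>
  Upper bound. The first moment bound on \<open>E (\<Sum>x. exp (\<lambda> H x))\<close>, with \<open>H x\<close> the number of clauses
  satisfied by \<open>x\<close>, gives \<open>(p c + sqrt (2 P Q ln 2 c) + O(1)) n\<close>, where the error term is positive if
  \<open>p < 1 / 2\<close> and would not vanish in the ratio for fixed \<open>c\<close>. It is absorbed by a strictly better
  coefficient of \<open>sqrt c\<close>: around an optimal assignment, flipping one variable in each block of \<open>r\<close>
  variables gives \<open>r^(n/r)\<close> assignments which on average lose only \<open>O(n sqrt c / r)\<close> clauses, and the
  entropy gain \<open>ln r / r\<close> exceeds this loss, of order \<open>1 / r\<close>, for large \<open>r\<close>.

  Lower bound. A discrete form of the Sudakov--Fernique comparison replaces the random clauses one
  by one by random signed single variables, at a cost \<open>O(\<beta>\<^sup>2)\<close> per clause at inverse temperature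
  \<open>\<beta> = O(1 / sqrt c)\<close>. It applies on any set of assignments on which the squared increments of the
  linear process are dominated by those of the clauses. The maximum of the linear process is a sum
  of absolute values of random walks. If \<open>g\<close> or its negation has a single satisfying point, all
  assignments are allowed; otherwise \<open>Q / k \<le> 1 / 4\<close>, and assignments with an odd number of true
  variables in each block of three suffice.
\<close>

subsection \<open>Averages over finite sets and lists\<close>

text \<open>Up to repeated indices, the squared increments of the clauses between \<open>x\<close>
  and \<open>y\<close> are given by the noise stability of \<open>g\<close> at the normalised
  distance \<open>d\<close>, where Fourier level \<open>s\<close> enters through
  \<open>(1 - 2 d)^s\<close>. Parity is the obstacle: if \<open>g\<close> is even, complementary
  assignments satisfy exactly the same clauses, so the clause increments vanish where those of a
  linear process are largest. Keeping all distances at most \<open>2/3\<close> avoids this. The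
  price is a smaller maximum of the linear process, at worst by the factor
  \<open>(1 + sqrt 2) / 3\<close>, as each triple of variables keeps only four of its eight sign
  patterns. A single satisfying point rules out the symmetry, and a linear bound then holds up to
  \<open>d = 1\<close>. The remaining errors are of order \<open>n\<close> or have an arbitrarily
  small coefficient of \<open>n sqrt c\<close>. So both sides need a coefficient of
  \<open>sqrt c\<close> strictly better than the claimed one; the numerical constants only have to
  provide this slack. For constant \<open>g\<close> there is no slack, and that case is treated
  apart.\<close>

definition avg :: "'a set \<Rightarrow> ('a \<Rightarrow> real) \<Rightarrow> real" where
  "avg S f = (\<Sum>s\<in>S. f s) / real (card S)"

definition seqs :: "'a set \<Rightarrow> nat \<Rightarrow> 'a list set" where
  "seqs S m = {xs. set xs \<subseteq> S \<and> length xs = m}"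

lemma avg_cong: "(\<And>s. s \<in> S \<Longrightarrow> f s = g s) \<Longrightarrow> avg S f = avg S g"
  by (simp add: avg_def)

lemma avg_add: "avg S (\<lambda>s. f s + g s) = avg S f + avg S g"
  by (simp add: avg_def sum.distrib add_divide_distrib)

lemma avg_diff: "avg S (\<lambda>s. f s - g s) = avg S f - avg S g"
  by (simp add: avg_def sum_subtractf diff_divide_distrib)

lemma avg_cmult: "avg S (\<lambda>s. c * f s) = c * avg S f"
  by (simp add: avg_def sum_distrib_left)

lemma avg_divide: "avg S (\<lambda>s. f s / c) = avg S f / c"
  by (simp add: avg_def sum_divide_distrib[symmetric] mult.commute)

lemma avg_cmult_right: "avg S (\<lambda>s. f s * c) = avg S f * c"
  by (simp add: avg_def sum_distrib_right)

lemma avg_sum: "avg S (\<lambda>s. \<Sum>i\<in>I. f i s) = (\<Sum>i\<in>I. avg S (f i))"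
  unfolding avg_def by (subst sum.swap) (simp add: sum_divide_distrib)

lemma avg_const: "finite S \<Longrightarrow> S \<noteq> {} \<Longrightarrow> avg S (\<lambda>_. c) = c"
  by (simp add: avg_def)

lemma avg_mono: "(\<And>s. s \<in> S \<Longrightarrow> f s \<le> g s) \<Longrightarrow> avg S f \<le> avg S g"
  by (simp add: avg_def divide_right_mono sum_mono)

lemma avg_nonneg: "(\<And>s. s \<in> S \<Longrightarrow> 0 \<le> f s) \<Longrightarrow> 0 \<le> avg S f"
  by (simp add: avg_def sum_nonneg)

lemma avg_le_const:
  "finite S \<Longrightarrow> S \<noteq> {} \<Longrightarrow> (\<And>s. s \<in> S \<Longrightarrow> f s \<le> c) \<Longrightarrow> avg S f \<le> c"
  using avg_mono[of S f "\<lambda>_. c"] by (simp add: avg_const)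

lemma avg_ge_const:
  "finite S \<Longrightarrow> S \<noteq> {} \<Longrightarrow> (\<And>s. s \<in> S \<Longrightarrow> c \<le> f s) \<Longrightarrow> c \<le> avg S f"
  using avg_mono[of S "\<lambda>_. c" f] by (simp add: avg_const)

lemma avg_swap: "avg S (\<lambda>s. avg T (f s)) = avg T (\<lambda>t. avg S (\<lambda>s. f s t))"
  unfolding avg_def sum_divide_distrib[symmetric] by (subst sum.swap) (simp add: mult.commute)

lemma avg_Times: "avg (S \<times> T) f = avg S (\<lambda>s. avg T (\<lambda>t. f (s, t)))"
  by (simp add: avg_def sum.cartesian_product[symmetric] sum_divide_distrib[symmetric]
      card_cartesian_product mult.commute sum.cartesian_product')

lemma avg_bij: "bij_betw h S S \<Longrightarrow> avg S (\<lambda>s. f (h s)) = avg S f"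
  by (simp add: avg_def sum.reindex_bij_betw)

lemma avg_UNIV_bool: "avg UNIV f = (f True + f False) / 2"
  by (simp add: avg_def UNIV_bool)

lemma finite_seqs [simp]: "finite S \<Longrightarrow> finite (seqs S m)"
  unfolding seqs_def by (rule finite_lists_length_eq)

lemma card_seqs: "finite S \<Longrightarrow> card (seqs S m) = card S ^ m"
  unfolding seqs_def by (rule card_lists_length_eq)

lemma seqs_nonempty [simp]: "S \<noteq> {} \<Longrightarrow> seqs S m \<noteq> {}"
proof -
  assume "S \<noteq> {}"
  then obtain s where "s \<in> S" by blast
  then have "replicate m s \<in> seqs S m" by (auto simp: seqs_def)
  then show ?thesis by blast
qed

lemma avg_seqs_0 [simp]: "avg (seqs S 0) f = f []"
proof -
  have "seqs S 0 = {[]}" by (auto simp: seqs_def)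
  then show ?thesis by (simp add: avg_def)
qed

lemma avg_seqs_Suc:
  "avg (seqs S (Suc m)) f = avg S (\<lambda>s. avg (seqs S m) (\<lambda>F. f (s # F)))"
proof -
  have eq: "seqs S (Suc m) = (\<lambda>(F, s). s # F) ` (seqs S m \<times> S)"
    unfolding seqs_def by (rule lists_length_Suc_eq)
  have inj: "inj_on (\<lambda>(F, s). s # F) (seqs S m \<times> S)"
    by (auto simp: inj_on_def)
  have "avg (seqs S (Suc m)) f = avg (seqs S m \<times> S) (\<lambda>(F, s). f (s # F))"
    unfolding avg_def eq sum.reindex[OF inj] card_image[OF inj] by (simp add: case_prod_unfold)
  then show ?thesis by (simp add: avg_Times avg_swap[of "seqs S m"])
qed

text \<open>Turns the expectation into a finite average, so that no integrability conditions arise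
  later.\<close>

lemma replicate_pmf_of_set:
  assumes "finite S" "S \<noteq> {}"
  shows "measure_pmf.expectation (replicate_pmf m (pmf_of_set S)) f = avg (seqs S m) f"
proof (induction m arbitrary: f)
  case 0
  then show ?case by simp
next
  case (Suc m)
  have fin: "finite (set_pmf (replicate_pmf m (pmf_of_set S)))"
    using finite_seqs[OF assms(1), of m] assms
    by (simp add: set_replicate_pmf seqs_def lists_eq_set conj_commute)
  have "measure_pmf.expectation (replicate_pmf (Suc m) (pmf_of_set S)) f =
      (\<Sum>s\<in>S. measure_pmf.expectation (replicate_pmf m (pmf_of_set S) \<bind> (\<lambda>F. return_pmf (s # F))) f
         /\<^sub>R real (card S))"
    using assms fin by (simp add: pmf_expectation_bind_pmf_of_set)
  also have "\<dots> = avg S (\<lambda>s. measure_pmf.expectation (replicate_pmf m (pmf_of_set S)) (\<lambda>F. f (s # F)))"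
    by (simp add: avg_def map_pmf_def[symmetric] sum_distrib_left divide_inverse_commute)
  also have "\<dots> = avg (seqs S (Suc m)) f"
    by (simp add: Suc.IH avg_seqs_Suc)
  finally show ?case .
qed

lemma avg_seqs_exp:
  "avg (seqs S m) (\<lambda>F. exp (\<Sum>C\<leftarrow>F. f C)) = avg S (\<lambda>C. exp (f C)) ^ m"
proof (induction m)
  case (Suc m)
  have "avg (seqs S (Suc m)) (\<lambda>F. exp (\<Sum>C\<leftarrow>F. f C)) =
      avg S (\<lambda>s. exp (f s) * avg (seqs S m) (\<lambda>F. exp (\<Sum>C\<leftarrow>F. f C)))"
    by (simp add: avg_seqs_Suc exp_add avg_cmult)
  then show ?case
    by (simp add: Suc.IH avg_cmult_right)
qed simp

text \<open>Jensen's inequality for \<open>ln\<close>: average the tangent bound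
  \<open>ln u \<le> u - 1\<close> at \<open>u = f s / avg S f\<close>.\<close>

lemma ln_avg_ge:
  assumes "finite S" "S \<noteq> {}" "\<And>s. s \<in> S \<Longrightarrow> 0 < f s"
  shows "avg S (\<lambda>s. ln (f s)) \<le> ln (avg S f)"
proof -
  have pos: "0 < avg S f"
    unfolding avg_def using assms by (intro divide_pos_pos sum_pos) (auto simp: card_gt_0_iff)
  have "ln (f s) \<le> ln (avg S f) + (f s / avg S f - 1)" if "s \<in> S" for s
    using ln_le_minus_one[of "f s / avg S f"] assms(3)[OF that] pos by (simp add: ln_div)
  then have "avg S (\<lambda>s. ln (f s)) \<le> avg S (\<lambda>s. ln (avg S f) + (f s / avg S f - 1))"
    by (rule avg_mono)
  also have "\<dots> = ln (avg S f)"
    using assms(1,2) pos by (simp add: avg_add avg_diff avg_const avg_divide)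
  finally show ?thesis .
qed

lemma exp_avg_le:
  assumes "finite S" "S \<noteq> {}"
  shows "exp (avg S f) \<le> avg S (\<lambda>s. exp (f s))"
  using ln_avg_ge[OF assms, of "\<lambda>s. exp (f s)"]
  by (metis exp_gt_zero exp_ln_iff exp_le_cancel_iff ln_exp assms avg_cong
      avg_def card_gt_0_iff divide_pos_pos of_nat_0_less_iff sum_pos)

text \<open>The annealed bound: Jensen moves the average inside the logarithm, and independence of
  the clauses makes the exponential moment at each \<open>x\<close> an \<open>m\<close>-th power. It
  serves both the number of satisfied clauses and the loss under block flips.\<close>

lemma avg_log_partition_le:
  fixes h :: "'c \<Rightarrow> 'x \<Rightarrow> real"
  assumes S: "finite S" "S \<noteq> {}" and X: "finite X" "X \<noteq> {}"
    and le: "\<And>x. x \<in> X \<Longrightarrow> avg S (\<lambda>C. exp (h C x)) \<le> exp b"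
  shows "avg (seqs S m) (\<lambda>F. ln (\<Sum>x\<in>X. exp (\<Sum>C\<leftarrow>F. h C x))) \<le> ln (card X) + m * b"
proof -
  have "avg (seqs S m) (\<lambda>F. ln (\<Sum>x\<in>X. exp (\<Sum>C\<leftarrow>F. h C x)))
      \<le> ln (avg (seqs S m) (\<lambda>F. \<Sum>x\<in>X. exp (\<Sum>C\<leftarrow>F. h C x)))"
    using S X by (intro ln_avg_ge) (auto intro!: sum_pos)
  also have "avg (seqs S m) (\<lambda>F. \<Sum>x\<in>X. exp (\<Sum>C\<leftarrow>F. h C x)) = (\<Sum>x\<in>X. avg S (\<lambda>C. exp (h C x)) ^ m)"
    by (simp add: avg_sum avg_seqs_exp)
  also have "ln \<dots> \<le> ln (card X * exp (m * b))"
  proof (rule ln_mono)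
    have pos: "0 < avg S (\<lambda>C. exp (h C x))" for x
      unfolding avg_def using S by (intro divide_pos_pos sum_pos) (auto simp: card_gt_0_iff)
    then show "0 < (\<Sum>x\<in>X. avg S (\<lambda>C. exp (h C x)) ^ m)"
      using X by (intro sum_pos) auto
    show "(\<Sum>x\<in>X. avg S (\<lambda>C. exp (h C x)) ^ m) \<le> card X * exp (m * b)"
    proof (rule sum_bounded_above)
      fix x assume "x \<in> X"
      then show "avg S (\<lambda>C. exp (h C x)) ^ m \<le> exp (m * b)"
        using power_mono[OF le, of x m] pos[of x] by (simp add: exp_of_nat_mult)
    qed
  qed
  also have "\<dots> = ln (card X) + m * b"
    using X by (simp add: ln_mult card_gt_0_iff)
  finally show ?thesis .
qed

section \<open>Second-order expansion of the cumulant generating function\<close>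

lemma exp_cubic_bound:
  fixes x :: real
  assumes "\<bar>x\<bar> \<le> 1 / 2"
  shows "\<bar>exp x - 1 - x - x\<^sup>2 / 2\<bar> \<le> \<bar>x\<bar> ^ 3 / 3"
proof -
  obtain t where t: "\<bar>t\<bar> \<le> \<bar>x\<bar>" "exp x = (\<Sum>m<3. x ^ m / fact m) + exp t / fact 3 * x ^ 3"
    using Maclaurin_exp_le by blast
  have "exp t \<le> exp (1 / 2)" using t(1) assms by simp
  also have "\<dots> \<le> 1 + 1 / 2 + (1 / 2)\<^sup>2" by (rule exp_bound) auto
  also have "\<dots> \<le> 2" by (simp add: power2_eq_square)
  finally have e: "exp t \<le> 2" .
  have "exp x - 1 - x - x\<^sup>2 / 2 = exp t / 6 * x ^ 3"
    using t(2) by (simp add: numeral_3_eq_3 power2_eq_square)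
  then have "\<bar>exp x - 1 - x - x\<^sup>2 / 2\<bar> = exp t / 6 * \<bar>x\<bar> ^ 3"
    by (simp only: abs_mult power_abs) simp
  also have "\<dots> \<le> 2 / 6 * \<bar>x\<bar> ^ 3"
    using e by (intro mult_right_mono) auto
  finally show ?thesis by simp
qed

text \<open>Mean plus half the variance, with a cubic remainder. Centring \<open>f\<close> at its
  mean \<open>M\<close> removes the linear term, so the excess \<open>Y\<close> is of order
  \<open>b^2\<close>, and passing from \<open>Y\<close> to \<open>ln (1 + Y)\<close> costs only
  \<open>Y^2\<close>, which is at most \<open>b^3\<close>.\<close>

lemma cumulant_bound:
  fixes w f :: "'x \<Rightarrow> real"
  assumes B: "finite B" and w: "\<And>x. x \<in> B \<Longrightarrow> 0 \<le> w x" "(\<Sum>x\<in>B. w x) = 1"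
    and f: "\<And>x. x \<in> B \<Longrightarrow> \<bar>f x\<bar> \<le> 1" and b: "0 \<le> b" "b \<le> 1 / 4"
  shows "\<bar>ln (\<Sum>x\<in>B. w x * exp (b * f x)) - b * (\<Sum>x\<in>B. w x * f x)
     - b\<^sup>2 / 2 * ((\<Sum>x\<in>B. w x * (f x)\<^sup>2) - (\<Sum>x\<in>B. w x * f x)\<^sup>2)\<bar> \<le> 4 * b ^ 3"
proof -
  define M where "M = (\<Sum>x\<in>B. w x * f x)"
  define V where "V = (\<Sum>x\<in>B. w x * (f x)\<^sup>2) - M\<^sup>2"
  define Y where "Y = (\<Sum>x\<in>B. w x * exp (b * (f x - M))) - 1"
  have "\<bar>M\<bar> \<le> (\<Sum>x\<in>B. w x * 1)"
    unfolding M_def using w f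
    by (intro order_trans[OF sum_abs] sum_mono) (auto simp: abs_mult intro!: mult_left_le)
  then have M: "\<bar>M\<bar> \<le> 1" using w by simp
  have "(\<Sum>x\<in>B. w x * (f x)\<^sup>2) \<le> (\<Sum>x\<in>B. w x * 1)"
    using w f by (intro sum_mono mult_left_mono) (auto simp: abs_square_le_1)
  then have V1: "V \<le> 1" using w by (simp add: V_def) (smt (verit) zero_le_power2)
  have Veq: "V = (\<Sum>x\<in>B. w x * (f x - M)\<^sup>2)"
  proof -
    have "(\<Sum>x\<in>B. w x * (f x - M)\<^sup>2) =
        (\<Sum>x\<in>B. w x * (f x)\<^sup>2) - 2 * M * (\<Sum>x\<in>B. w x * f x) + M\<^sup>2 * (\<Sum>x\<in>B. w x)"
      by (simp add: power2_diff sum_distrib_left sum_distrib_right sum.distrib sum_subtractf algebra_simps)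
    then show ?thesis using w by (simp add: V_def M_def[symmetric] power2_eq_square)
  qed
  have V0: "0 \<le> V" unfolding Veq using w by (intro sum_nonneg) auto
  \<comment> \<open>Both \<open>f x\<close> and \<open>M\<close> lie in \<open>[-1, 1]\<close>;
    \<open>b \<le> 1 / 4\<close> then puts the exponent in the range \<open>1 / 2\<close> of
    \<open>exp_cubic_bound\<close>.\<close>
  have t: "\<bar>b * (f x - M)\<bar> \<le> 2 * b" if "x \<in> B" for x
  proof -
    have "b * \<bar>f x - M\<bar> \<le> b * 2"
      using f[OF that] M b by (intro mult_left_mono) auto
    then show ?thesis using b by (simp add: abs_mult)
  qed
  have Yeq: "Y - b\<^sup>2 / 2 * V =
      (\<Sum>x\<in>B. w x * (exp (b * (f x - M)) - 1 - b * (f x - M) - (b * (f x - M))\<^sup>2 / 2))"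
  proof -
    have "(\<Sum>x\<in>B. w x * (exp (b * (f x - M)) - 1 - b * (f x - M) - (b * (f x - M))\<^sup>2 / 2)) =
        (\<Sum>x\<in>B. w x * exp (b * (f x - M))) - (\<Sum>x\<in>B. w x)
        - b * ((\<Sum>x\<in>B. w x * f x) - M * (\<Sum>x\<in>B. w x)) - b\<^sup>2 / 2 * (\<Sum>x\<in>B. w x * (f x - M)\<^sup>2)"
      unfolding sum_distrib_left sum_subtractf[symmetric]
      by (intro sum.cong refl) (simp add: power2_eq_square field_simps)
    then show ?thesis using w by (simp add: Y_def Veq M_def[symmetric])
  qed
  have "\<bar>Y - b\<^sup>2 / 2 * V\<bar> \<le> (\<Sum>x\<in>B. w x * (8 / 3 * b ^ 3))"
    unfolding Yeq
  proof (intro order_trans[OF sum_abs] sum_mono)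
    fix x assume x: "x \<in> B"
    have "\<bar>exp (b * (f x - M)) - 1 - b * (f x - M) - (b * (f x - M))\<^sup>2 / 2\<bar> \<le> \<bar>b * (f x - M)\<bar> ^ 3 / 3"
      using t[OF x] b by (intro exp_cubic_bound) auto
    also have "\<dots> \<le> (2 * b) ^ 3 / 3"
      using t[OF x] by (intro divide_right_mono power_mono) auto
    also have "\<dots> = 8 / 3 * b ^ 3" by (simp add: power_mult_distrib)
    finally have e: "\<bar>exp (b * (f x - M)) - 1 - b * (f x - M) - (b * (f x - M))\<^sup>2 / 2\<bar> \<le> 8 / 3 * b ^ 3" .
    show "\<bar>w x * (exp (b * (f x - M)) - 1 - b * (f x - M) - (b * (f x - M))\<^sup>2 / 2)\<bar>
        \<le> w x * (8 / 3 * b ^ 3)"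
      unfolding abs_mult abs_of_nonneg[OF w(1)[OF x]] by (intro mult_left_mono e w(1) x)
  qed
  then have Y1: "\<bar>Y - b\<^sup>2 / 2 * V\<bar> \<le> 8 / 3 * b ^ 3"
    unfolding sum_distrib_right[symmetric] w(2) by simp
  have "(\<Sum>x\<in>B. w x * (1 + b * (f x - M))) \<le> (\<Sum>x\<in>B. w x * exp (b * (f x - M)))"
    using w by (intro sum_mono mult_left_mono) auto
  moreover have "(\<Sum>x\<in>B. w x * (1 + b * (f x - M))) =
      (\<Sum>x\<in>B. w x) + b * ((\<Sum>x\<in>B. w x * f x) - M * (\<Sum>x\<in>B. w x))"
    by (simp add: sum_distrib_left sum.distrib sum_subtractf algebra_simps)
  ultimately have Y0: "0 \<le> Y" using w by (simp add: Y_def M_def[symmetric])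
  have b3: "b ^ 3 \<le> b\<^sup>2 / 4"
    using mult_left_mono[OF b(2), of "b\<^sup>2"] by (simp add: power3_eq_cube power2_eq_square)
  have "b\<^sup>2 * V \<le> b\<^sup>2" using V1 by (simp add: mult_left_le)
  then have Y2: "Y \<le> 7 / 6 * b\<^sup>2" using Y1 b3 by linarith
  have b2: "b\<^sup>2 \<le> 1 / 16" using power_mono[OF b(2,1), of 2] by (simp add: power2_eq_square)
  have "Y\<^sup>2 \<le> (7 / 6 * b\<^sup>2)\<^sup>2" using Y0 Y2 by (rule power_mono[rotated])
  also have "\<dots> = 49 / 36 * b * b ^ 3" by (simp add: power2_eq_square power3_eq_cube)
  also have "\<dots> \<le> 49 / 36 * (1 / 4) * b ^ 3" using b by (intro mult_right_mono) auto
  also have "\<dots> \<le> b ^ 3" using b by simp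
  finally have Ysq: "Y\<^sup>2 \<le> b ^ 3" .
  have ln1: "ln (1 + Y) \<le> Y" using Y0 by (rule ln_add_one_self_le_self)
  have ln2: "Y - Y\<^sup>2 \<le> ln (1 + Y)"
    using Y0 Y2 b2 by (intro ln_one_plus_pos_lower_bound) auto
  have "(\<Sum>x\<in>B. w x * exp (b * f x)) = exp (b * M) * (1 + Y)"
    unfolding Y_def by (simp add: sum_distrib_left exp_diff right_diff_distrib)
  then have "ln (\<Sum>x\<in>B. w x * exp (b * f x)) = b * M + ln (1 + Y)"
    using Y0 by (simp add: ln_mult)
  \<comment> \<open>The errors \<open>8/3 b^3\<close> from \<open>Y\<close> and \<open>b^3\<close>
    from the logarithm stay below \<open>4 b^3\<close>.\<close>
  moreover have "\<bar>ln (1 + Y) - b\<^sup>2 / 2 * V\<bar> \<le> 4 * b ^ 3"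
  proof -
    have "0 \<le> b ^ 3" using b by simp
    then show ?thesis using ln1 ln2 Ysq Y1 by linarith
  qed
  ultimately show ?thesis by (simp add: M_def[symmetric] V_def)
qed

subsection \<open>Comparison of expected maxima\<close>

text \<open>The variance is half the mean squared difference of two independent copies. In this form
  it exposes the squared increments, the only quantity in which the two processes are
  compared.\<close>

lemma variance_eq_pairs:
  fixes w f :: "'x \<Rightarrow> real"
  assumes "(\<Sum>x\<in>B. w x) = 1"
  shows "(\<Sum>x\<in>B. w x * (f x)\<^sup>2) - (\<Sum>x\<in>B. w x * f x)\<^sup>2
    = (\<Sum>x\<in>B. \<Sum>y\<in>B. w x * w y * (f x - f y)\<^sup>2) / 2"
proof -
  have 1: "(\<Sum>x\<in>B. \<Sum>y\<in>B. (w x * (f x)\<^sup>2) * w y) = (\<Sum>x\<in>B. w x * (f x)\<^sup>2)"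
    using assms by (simp add: sum_distrib_left[symmetric])
  have 2: "(\<Sum>x\<in>B. \<Sum>y\<in>B. w x * (w y * (f y)\<^sup>2)) = (\<Sum>x\<in>B. w x * (f x)\<^sup>2)"
    using assms by (simp add: sum_distrib_left[symmetric] sum_distrib_right[symmetric])
  have 3: "(\<Sum>x\<in>B. \<Sum>y\<in>B. (w x * f x) * (w y * f y)) = (\<Sum>x\<in>B. w x * f x)\<^sup>2"
    by (simp add: sum_distrib_left[symmetric] sum_distrib_right[symmetric] power2_eq_square)
  have "(\<Sum>x\<in>B. \<Sum>y\<in>B. w x * w y * (f x - f y)\<^sup>2) =
      (\<Sum>x\<in>B. \<Sum>y\<in>B. (w x * (f x)\<^sup>2) * w y) + (\<Sum>x\<in>B. \<Sum>y\<in>B. w x * (w y * (f y)\<^sup>2))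
      - 2 * (\<Sum>x\<in>B. \<Sum>y\<in>B. (w x * f x) * (w y * f y))"
    unfolding sum_distrib_left sum.distrib[symmetric] sum_subtractf[symmetric]
    by (intro sum.cong) (auto simp: power2_eq_square algebra_simps)
  then show ?thesis by (simp add: 1 2 3)
qed

text \<open>One more random term multiplies the partition function by a Gibbs average under the
  weights \<open>w\<close>, to which the cumulant expansion applies. As every \<open>x\<close> has
  the same mean \<open>p\<close>, the linear term is \<open>b * p\<close> whatever \<open>w\<close>
  is, and to second order \<open>f\<close> enters only through its averaged squared
  increments.\<close>

lemma avg_log_partition_expand:
  fixes f :: "'c \<Rightarrow> 'x \<Rightarrow> real" and H :: "'x \<Rightarrow> real"
  assumes B: "finite B" "B \<noteq> {}" and A: "finite A" "A \<noteq> {}"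
    and bound: "\<And>C x. C \<in> A \<Longrightarrow> x \<in> B \<Longrightarrow> \<bar>f C x\<bar> \<le> 1"
    and mean: "\<And>x. x \<in> B \<Longrightarrow> avg A (\<lambda>C. f C x) = p"
    and b: "0 \<le> b" "b \<le> 1 / 4"
  defines "w \<equiv> \<lambda>x. exp (b * H x) / (\<Sum>y\<in>B. exp (b * H y))"
  shows "\<bar>avg A (\<lambda>C. ln (\<Sum>x\<in>B. exp (b * (H x + f C x)))) - ln (\<Sum>x\<in>B. exp (b * H x)) - b * p
    - b\<^sup>2 / 4 * (\<Sum>x\<in>B. \<Sum>y\<in>B. w x * w y * avg A (\<lambda>C. (f C x - f C y)\<^sup>2))\<bar> \<le> 4 * b ^ 3"
proof -
  define Z where "Z = (\<Sum>x\<in>B. exp (b * H x))"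
  have Z: "0 < Z" unfolding Z_def using B by (intro sum_pos) auto
  have w: "0 \<le> w x" for x
    using Z by (simp add: w_def Z_def)
  have w1: "(\<Sum>x\<in>B. w x) = 1"
    using Z by (simp add: w_def Z_def sum_divide_distrib[symmetric])
  define R where "R C = ln (\<Sum>x\<in>B. exp (b * (H x + f C x))) - ln Z - b * (\<Sum>x\<in>B. w x * f C x)
     - b\<^sup>2 / 4 * (\<Sum>x\<in>B. \<Sum>y\<in>B. w x * w y * (f C x - f C y)\<^sup>2)" for C
  have R: "\<bar>R C\<bar> \<le> 4 * b ^ 3" if C: "C \<in> A" for C
  proof -
    have eq: "(\<Sum>x\<in>B. exp (b * (H x + f C x))) = Z * (\<Sum>x\<in>B. w x * exp (b * f C x))"
      using Z by (simp add: w_def Z_def[symmetric] sum_distrib_left distrib_left exp_add)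
    have pos: "0 < (\<Sum>x\<in>B. w x * exp (b * f C x))"
      using B Z by (intro sum_pos) (auto simp: w_def Z_def[symmetric])
    have "\<bar>ln (\<Sum>x\<in>B. w x * exp (b * f C x)) - b * (\<Sum>x\<in>B. w x * f C x)
      - b\<^sup>2 / 2 * ((\<Sum>x\<in>B. w x * (f C x)\<^sup>2) - (\<Sum>x\<in>B. w x * f C x)\<^sup>2)\<bar> \<le> 4 * b ^ 3"
      using B w w1 bound[OF C] b by (intro cumulant_bound) auto
    then show ?thesis
      unfolding R_def eq using Z pos by (simp add: ln_mult variance_eq_pairs[OF w1])
  qed
  have "avg A (\<lambda>C. \<Sum>x\<in>B. w x * f C x) = p"
    using w1 by (simp add: avg_sum avg_cmult mean sum_distrib_right[symmetric])
  moreover have "avg A (\<lambda>C. \<Sum>x\<in>B. \<Sum>y\<in>B. w x * w y * (f C x - f C y)\<^sup>2) =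
      (\<Sum>x\<in>B. \<Sum>y\<in>B. w x * w y * avg A (\<lambda>C. (f C x - f C y)\<^sup>2))"
    by (simp add: avg_sum avg_cmult)
  ultimately have "avg A R = avg A (\<lambda>C. ln (\<Sum>x\<in>B. exp (b * (H x + f C x)))) - ln Z - b * p
     - b\<^sup>2 / 4 * (\<Sum>x\<in>B. \<Sum>y\<in>B. w x * w y * avg A (\<lambda>C. (f C x - f C y)\<^sup>2))"
    unfolding R_def avg_diff avg_cmult using A by (simp add: avg_const)
  moreover have "avg A R \<le> 4 * b ^ 3" "- (4 * b ^ 3) \<le> avg A R"
    using R by (auto intro!: avg_le_const avg_ge_const A simp: abs_le_iff)
      (metis minus_le_iff)
  ultimately show ?thesis by (simp add: Z_def abs_le_iff)
qed

text \<open>Both expansions use the same Gibbs weights, since these depend on \<open>H\<close> only.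
  Hence the second-order terms are ordered by \<open>incr\<close>, term by term. The slack
  \<open>\<delta>\<close> will absorb the error from clauses having distinct indices.\<close>

lemma interpolation_step:
  fixes f :: "'c \<Rightarrow> 'x \<Rightarrow> real" and h :: "'d \<Rightarrow> 'x \<Rightarrow> real"
  assumes B: "finite B" "B \<noteq> {}" and A: "finite A" "A \<noteq> {}" and L: "finite L" "L \<noteq> {}"
    and f: "\<And>C x. C \<in> A \<Longrightarrow> x \<in> B \<Longrightarrow> \<bar>f C x\<bar> \<le> 1"
    and h: "\<And>C x. C \<in> L \<Longrightarrow> x \<in> B \<Longrightarrow> \<bar>h C x\<bar> \<le> 1"
    and fmean: "\<And>x. x \<in> B \<Longrightarrow> avg A (\<lambda>C. f C x) = p"
    and hmean: "\<And>x. x \<in> B \<Longrightarrow> avg L (\<lambda>C. h C x) = 0"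
    and incr: "\<And>x y. x \<in> B \<Longrightarrow> y \<in> B \<Longrightarrow>
      avg L (\<lambda>C. (h C x - h C y)\<^sup>2) \<le> avg A (\<lambda>C. (f C x - f C y)\<^sup>2) + \<delta>"
    and b: "0 \<le> b" "b \<le> 1 / 4"
  shows "avg L (\<lambda>C. ln (\<Sum>x\<in>B. exp (b * (H x + h C x)))) + (b * p - 8 * b ^ 3 - b\<^sup>2 * \<delta> / 4)
    \<le> avg A (\<lambda>C. ln (\<Sum>x\<in>B. exp (b * (H x + f C x))))"
proof -
  define w where "w x = exp (b * H x) / (\<Sum>y\<in>B. exp (b * H y))" for x
  have Z: "0 < (\<Sum>x\<in>B. exp (b * H x))" using B by (intro sum_pos) auto
  have w: "0 \<le> w x" for x
    using Z by (simp add: w_def)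
  have w1: "(\<Sum>x\<in>B. w x) = 1"
    using Z by (simp add: w_def sum_divide_distrib[symmetric])
  let ?P = "\<lambda>S u. \<Sum>x\<in>B. \<Sum>y\<in>B. w x * w y * avg S (\<lambda>C. (u C x - u C y)\<^sup>2)"
  have "?P L h \<le> (\<Sum>x\<in>B. \<Sum>y\<in>B. w x * w y * (avg A (\<lambda>C. (f C x - f C y)\<^sup>2) + \<delta>))"
    using incr w by (intro sum_mono mult_left_mono mult_nonneg_nonneg) auto
  also have "\<dots> = ?P A f + (\<Sum>x\<in>B. w x * (\<Sum>y\<in>B. w y)) * \<delta>"
    by (simp add: distrib_left sum.distrib sum_distrib_left sum_distrib_right)
  finally have "?P L h \<le> ?P A f + \<delta>" by (simp add: w1)
  then have *: "b\<^sup>2 / 4 * ?P L h \<le> b\<^sup>2 / 4 * ?P A f + b\<^sup>2 * \<delta> / 4"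
    using mult_left_mono[of "?P L h" "?P A f + \<delta>" "b\<^sup>2 / 4"] by (simp add: algebra_simps)
  have "\<bar>avg A (\<lambda>C. ln (\<Sum>x\<in>B. exp (b * (H x + f C x)))) - ln (\<Sum>x\<in>B. exp (b * H x)) - b * p
      - b\<^sup>2 / 4 * ?P A f\<bar> \<le> 4 * b ^ 3"
    unfolding w_def by (rule avg_log_partition_expand) (use assms in auto)
  moreover have "\<bar>avg L (\<lambda>C. ln (\<Sum>x\<in>B. exp (b * (H x + h C x)))) - ln (\<Sum>x\<in>B. exp (b * H x)) - b * 0
      - b\<^sup>2 / 4 * ?P L h\<bar> \<le> 4 * b ^ 3"
    unfolding w_def by (rule avg_log_partition_expand) (use assms in auto)
  ultimately show ?thesis
    using * unfolding abs_le_iff by linarith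
qed

text \<open>Lindeberg replacement, one term at a time. The field \<open>H\<close> carries the terms
  that are not being exchanged, hence the induction is over arbitrary \<open>H\<close>.\<close>

lemma interpolation:
  fixes f :: "'c \<Rightarrow> 'x \<Rightarrow> real" and h :: "'d \<Rightarrow> 'x \<Rightarrow> real"
  assumes B: "finite B" "B \<noteq> {}" and A: "finite A" "A \<noteq> {}" and L: "finite L" "L \<noteq> {}"
    and f: "\<And>C x. C \<in> A \<Longrightarrow> x \<in> B \<Longrightarrow> \<bar>f C x\<bar> \<le> 1"
    and h: "\<And>C x. C \<in> L \<Longrightarrow> x \<in> B \<Longrightarrow> \<bar>h C x\<bar> \<le> 1"
    and fmean: "\<And>x. x \<in> B \<Longrightarrow> avg A (\<lambda>C. f C x) = p"
    and hmean: "\<And>x. x \<in> B \<Longrightarrow> avg L (\<lambda>C. h C x) = 0"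
    and incr: "\<And>x y. x \<in> B \<Longrightarrow> y \<in> B \<Longrightarrow>
      avg L (\<lambda>C. (h C x - h C y)\<^sup>2) \<le> avg A (\<lambda>C. (f C x - f C y)\<^sup>2) + \<delta>"
    and b: "0 \<le> b" "b \<le> 1 / 4"
  shows "avg (seqs L m) (\<lambda>F. ln (\<Sum>x\<in>B. exp (b * (H x + (\<Sum>C\<leftarrow>F. h C x)))))
      + m * (b * p - 8 * b ^ 3 - b\<^sup>2 * \<delta> / 4)
    \<le> avg (seqs A m) (\<lambda>F. ln (\<Sum>x\<in>B. exp (b * (H x + (\<Sum>C\<leftarrow>F. f C x)))))"
proof (induction m arbitrary: H)
  case 0
  then show ?case by simp
next
  case (Suc m)
  define \<kappa> where "\<kappa> = b * p - 8 * b ^ 3 - b\<^sup>2 * \<delta> / 4"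
  define lse where "lse G = ln (\<Sum>x\<in>B. exp (b * G x))" for G :: "'x \<Rightarrow> real"
  have IH: "avg (seqs L m) (\<lambda>F. lse (\<lambda>x. G x + (\<Sum>C\<leftarrow>F. h C x))) + m * \<kappa>
      \<le> avg (seqs A m) (\<lambda>F. lse (\<lambda>x. G x + (\<Sum>C\<leftarrow>F. f C x)))" for G
    using Suc.IH[of G] by (simp add: lse_def \<kappa>_def)
  have step: "avg L (\<lambda>C. lse (\<lambda>x. G x + h C x)) + \<kappa> \<le> avg A (\<lambda>C. lse (\<lambda>x. G x + f C x))" for G
    unfolding lse_def \<kappa>_def by (rule interpolation_step) (use assms in auto)
  have Lm: "finite (seqs L m)" "seqs L m \<noteq> {}" using L by auto
  have "avg (seqs L (Suc m)) (\<lambda>F. lse (\<lambda>x. H x + (\<Sum>C\<leftarrow>F. h C x))) + Suc m * \<kappa>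
      = avg (seqs L m) (\<lambda>F. avg L (\<lambda>C. lse (\<lambda>x. (H x + (\<Sum>C\<leftarrow>F. h C x)) + h C x)) + \<kappa>) + m * \<kappa>"
    using Lm by (simp add: avg_seqs_Suc avg_swap[of L] avg_add avg_const algebra_simps)
  also have "\<dots> \<le> avg (seqs L m) (\<lambda>F. avg A (\<lambda>C. lse (\<lambda>x. (H x + (\<Sum>C\<leftarrow>F. h C x)) + f C x))) + m * \<kappa>"
    by (intro add_right_mono avg_mono step)
  also have "\<dots> = avg A (\<lambda>C. avg (seqs L m) (\<lambda>F. lse (\<lambda>x. (H x + f C x) + (\<Sum>C\<leftarrow>F. h C x))) + m * \<kappa>)"
    using A by (simp add: avg_swap[of A] avg_add avg_const algebra_simps)
  also have "\<dots> \<le> avg A (\<lambda>C. avg (seqs A m) (\<lambda>F. lse (\<lambda>x. (H x + f C x) + (\<Sum>C\<leftarrow>F. f C x))))"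
    by (intro avg_mono IH)
  also have "\<dots> = avg (seqs A (Suc m)) (\<lambda>F. lse (\<lambda>x. H x + (\<Sum>C\<leftarrow>F. f C x)))"
    by (simp add: avg_seqs_Suc add.assoc)
  finally show ?case by (simp add: lse_def \<kappa>_def)
qed

text \<open>The log-partition function divided by \<open>b\<close> differs from the maximum by at
  most \<open>ln (card B) / b\<close>. For \<open>b = a / sqrt c\<close> and about
  \<open>c n\<close> terms this error is at most \<open>n sqrt c ln 2 / a\<close>, with a
  coefficient made small by large \<open>a\<close>, while \<open>8 b^2\<close> per term adds up to
  \<open>8 a^2 n\<close>. Nothing requires \<open>N\<close> to be optimal: any value attained on
  \<open>B\<close> will do.\<close>

lemma expected_max_comparison:
  fixes f :: "'c \<Rightarrow> 'x \<Rightarrow> real" and h :: "'d \<Rightarrow> 'x \<Rightarrow> real"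
  assumes B: "finite B" "B \<noteq> {}" and A: "finite A" "A \<noteq> {}" and L: "finite L" "L \<noteq> {}"
    and f: "\<And>C x. C \<in> A \<Longrightarrow> x \<in> B \<Longrightarrow> \<bar>f C x\<bar> \<le> 1"
    and h: "\<And>C x. C \<in> L \<Longrightarrow> x \<in> B \<Longrightarrow> \<bar>h C x\<bar> \<le> 1"
    and fmean: "\<And>x. x \<in> B \<Longrightarrow> avg A (\<lambda>C. f C x) = p"
    and hmean: "\<And>x. x \<in> B \<Longrightarrow> avg L (\<lambda>C. h C x) = 0"
    and incr: "\<And>x y. x \<in> B \<Longrightarrow> y \<in> B \<Longrightarrow>
      avg L (\<lambda>C. (h C x - h C y)\<^sup>2) \<le> avg A (\<lambda>C. (f C x - f C y)\<^sup>2) + \<delta>"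
    and b: "0 < b" "b \<le> 1 / 4"
    and M: "\<And>F x. F \<in> seqs A m \<Longrightarrow> x \<in> B \<Longrightarrow> (\<Sum>C\<leftarrow>F. f C x) \<le> M F"
    and N: "\<And>F. F \<in> seqs L m \<Longrightarrow> \<exists>x\<in>B. N F \<le> (\<Sum>C\<leftarrow>F. h C x)"
  shows "avg (seqs L m) N + m * p - ln (card B) / b - m * (8 * b\<^sup>2 + b * \<delta> / 4) \<le> avg (seqs A m) M"
proof -
  have up: "ln (\<Sum>x\<in>B. exp (b * (0 + (\<Sum>C\<leftarrow>F. f C x)))) \<le> ln (card B) + b * M F" if "F \<in> seqs A m" for F
  proof -
    have "(\<Sum>x\<in>B. exp (b * (0 + (\<Sum>C\<leftarrow>F. f C x)))) \<le> card B * exp (b * M F)"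
      using M[OF that] b by (intro sum_bounded_above) auto
    moreover have "0 < (\<Sum>x\<in>B. exp (b * (0 + (\<Sum>C\<leftarrow>F. f C x))))"
      using B by (intro sum_pos) auto
    ultimately have "ln (\<Sum>x\<in>B. exp (b * (0 + (\<Sum>C\<leftarrow>F. f C x)))) \<le> ln (card B * exp (b * M F))"
      by (intro ln_mono)
    then show ?thesis using B by (simp add: ln_mult card_gt_0_iff)
  qed
  have lo: "b * N F \<le> ln (\<Sum>x\<in>B. exp (b * (0 + (\<Sum>C\<leftarrow>F. h C x))))" if F: "F \<in> seqs L m" for F
  proof -
    obtain x where x: "x \<in> B" "N F \<le> (\<Sum>C\<leftarrow>F. h C x)" using N[OF F] by blast
    have "exp (b * N F) \<le> exp (b * (0 + (\<Sum>C\<leftarrow>F. h C x)))" using x b by simp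
    also have "\<dots> \<le> (\<Sum>x\<in>B. exp (b * (0 + (\<Sum>C\<leftarrow>F. h C x))))"
      using x B by (intro member_le_sum) auto
    finally have "exp (b * N F) \<le> (\<Sum>x\<in>B. exp (b * (0 + (\<Sum>C\<leftarrow>F. h C x))))" .
    then show ?thesis using ln_ge_iff exp_gt_zero less_le_trans by blast
  qed
  have "b * avg (seqs L m) N + m * (b * p - 8 * b ^ 3 - b\<^sup>2 * \<delta> / 4)
      \<le> avg (seqs L m) (\<lambda>F. ln (\<Sum>x\<in>B. exp (b * (0 + (\<Sum>C\<leftarrow>F. h C x)))))
        + m * (b * p - 8 * b ^ 3 - b\<^sup>2 * \<delta> / 4)"
    unfolding avg_cmult[symmetric] using lo by (intro add_right_mono avg_mono)
  also have "\<dots> \<le> avg (seqs A m) (\<lambda>F. ln (\<Sum>x\<in>B. exp (b * (0 + (\<Sum>C\<leftarrow>F. f C x)))))"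
    using assms by (intro interpolation) auto
  also have "\<dots> \<le> avg (seqs A m) (\<lambda>F. ln (card B) + b * M F)"
    using up by (intro avg_mono)
  also have "\<dots> = ln (card B) + b * avg (seqs A m) M"
    using A by (simp add: avg_add avg_const avg_cmult)
  finally have "b * avg (seqs L m) N + m * (b * p - 8 * b ^ 3 - b\<^sup>2 * \<delta> / 4) - ln (card B)
    \<le> b * avg (seqs A m) M" by simp
  moreover have "b * (avg (seqs L m) N + m * p - ln (card B) / b - m * (8 * b\<^sup>2 + b * \<delta> / 4))
     = b * avg (seqs L m) N + m * (b * p - 8 * b ^ 3 - b\<^sup>2 * \<delta> / 4) - ln (card B)"
    using b by (simp add: field_simps power2_eq_square power3_eq_cube)
  ultimately have "b * (avg (seqs L m) N + m * p - ln (card B) / b - m * (8 * b\<^sup>2 + b * \<delta> / 4))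
     \<le> b * avg (seqs A m) M" by simp
  then show ?thesis using b by simp
qed

subsection \<open>Expected absolute value of a lazy random walk\<close>

text \<open>The transition operator of simple random walk: \<open>(walk_step ^^ D) f x\<close> is
  the mean of \<open>f\<close> after \<open>D\<close> steps from \<open>x\<close>.\<close>

definition walk_step :: "(int \<Rightarrow> real) \<Rightarrow> int \<Rightarrow> real" where
  "walk_step f x = (f (x + 1) + f (x - 1)) / 2"

lemma walk_step_pow_add:
  "(walk_step ^^ D) (\<lambda>x. f x + g x) = (\<lambda>x. (walk_step ^^ D) f x + (walk_step ^^ D) g x)"
  by (induction D) (auto simp: walk_step_def fun_eq_iff field_simps)

lemma walk_step_pow_zero_above:
  assumes "\<And>x. x > 0 \<Longrightarrow> f x = 0" "x > int D"
  shows "(walk_step ^^ D) f x = 0"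
  using assms(2)
proof (induction D arbitrary: x)
  case (Suc D)
  then show ?case using Suc.IH[of "x + 1"] Suc.IH[of "x - 1"] by (simp add: walk_step_def)
qed (simp add: assms)

abbreviation at_zero :: "int \<Rightarrow> real" where
  "at_zero \<equiv> \<lambda>x. of_bool (x = 0)"

text \<open>Averaging the two neighbours is Pascal's rule. At \<open>i = 0\<close> one neighbour
  lies beyond the reach of the walk and contributes nothing.\<close>

lemma walk_return_prob: "(walk_step ^^ D) at_zero (int D - 2 * int i) = real (D choose i) / 2 ^ D"
proof (induction D arbitrary: i)
  case 0
  then show ?case by (cases i) auto
next
  case (Suc D)
  show ?case
  proof (cases i)
    case 0
    have "(walk_step ^^ D) at_zero (int D + 2) = 0"
      by (rule walk_step_pow_zero_above) auto
    then show ?thesis using Suc.IH[of 0] 0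
      by (simp add: walk_step_def[of "(walk_step ^^ D) at_zero"] add.commute)
  next
    case (Suc j)
    have "int (Suc D) - 2 * int i + 1 = int D - 2 * int j" "int (Suc D) - 2 * int i - 1 = int D - 2 * int i"
      using Suc by auto
    then have "(walk_step ^^ Suc D) at_zero (int (Suc D) - 2 * int i) =
        ((walk_step ^^ D) at_zero (int D - 2 * int j) + (walk_step ^^ D) at_zero (int D - 2 * int i)) / 2"
      by (simp only: funpow.simps o_def walk_step_def[of "(walk_step ^^ D) at_zero"])
    then show ?thesis
      unfolding Suc.IH by (simp add: Suc field_simps del: funpow.simps)
  qed
qed

text \<open>Discrete Tanaka formula: the absolute value is harmonic except at the origin. Hence the
  mean absolute value of the walk is a sum of return probabilities, as \<open>walk_abs_Suc\<close>
  records.\<close>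

lemma walk_step_abs: "walk_step (\<lambda>x. \<bar>real_of_int x\<bar>) = (\<lambda>x. \<bar>real_of_int x\<bar> + at_zero x)"
  by (rule ext) (auto simp: walk_step_def abs_if)

definition walk_abs :: "nat \<Rightarrow> real" where
  "walk_abs D = (walk_step ^^ D) (\<lambda>x. \<bar>real_of_int x\<bar>) 0"

lemma walk_step_pow_nonneg: "(\<And>x. 0 \<le> f x) \<Longrightarrow> 0 \<le> (walk_step ^^ D) f x"
  by (induction D arbitrary: x) (auto simp: walk_step_def)

lemma walk_abs_Suc: "walk_abs (Suc D) = walk_abs D + (walk_step ^^ D) at_zero 0"
  unfolding walk_abs_def funpow_Suc_right o_def walk_step_abs walk_step_pow_add by simp

lemma walk_abs_nonneg: "0 \<le> walk_abs D"
  unfolding walk_abs_def by (rule walk_step_pow_nonneg) simp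

lemma walk_abs_le_Suc: "walk_abs D \<le> walk_abs (Suc D)"
  unfolding walk_abs_Suc by (simp add: walk_step_pow_nonneg)

text \<open>The probability that the walk is back at its start after \<open>2 * m\<close>
  steps.\<close>

definition central :: "nat \<Rightarrow> real" where
  "central m = real (2 * m choose m) / 4 ^ m"

lemma central_Suc: "central (Suc m) * (2 * real m + 2) = central m * (2 * real m + 1)"
proof -
  have 1: "Suc m * (2 * Suc m choose Suc m) = 2 * Suc m * (Suc (2 * m) choose m)"
    using Suc_times_binomial_eq[of "Suc (2 * m)" m] by (simp add: mult.commute)
  have 2: "Suc m * (Suc (2 * m) choose m) = Suc (2 * m) * (2 * m choose m)"
  proof -
    have "Suc (2 * m) choose m = Suc (2 * m) choose Suc m"
      using binomial_symmetric[of m "Suc (2 * m)"] by simp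
    then show ?thesis using Suc_times_binomial_eq[of "2 * m" m] by (simp add: mult.commute)
  qed
  from 1 have "Suc m * (2 * Suc m choose Suc m) = Suc m * (2 * (Suc (2 * m) choose m))"
    by (simp only: ac_simps)
  then have "2 * Suc m choose Suc m = 2 * (Suc (2 * m) choose m)"
    by (simp only: mult_cancel1) auto
  with 2 have "Suc m * (2 * Suc m choose Suc m) = 2 * (Suc (2 * m) * (2 * m choose m))"
    by (metis mult.left_commute)
  then have "real (Suc m * (2 * Suc m choose Suc m)) = real (2 * (Suc (2 * m) * (2 * m choose m)))"
    by (simp only:)
  then have "real (2 * Suc m choose Suc m) * (real m + 1) = 2 * (2 * real m + 1) * real (2 * m choose m)"
    by (simp only: of_nat_mult of_nat_Suc of_nat_numeral) (simp add: algebra_simps del: binomial_Suc_Suc)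
  then have "real (2 * Suc m choose Suc m) * (real m + 1) / (2 * 4 ^ m) =
      2 * (2 * real m + 1) * real (2 * m choose m) / (2 * 4 ^ m)"
    by (simp only:)
  moreover have "central (Suc m) * (2 * real m + 2) =
      real (2 * Suc m choose Suc m) * (real m + 1) / (2 * 4 ^ m)"
    unfolding central_def by (simp add: field_simps del: binomial_Suc_Suc)
  moreover have "central m * (2 * real m + 1) =
      2 * (2 * real m + 1) * real (2 * m choose m) / (2 * 4 ^ m)"
    unfolding central_def by (simp add: field_simps)
  ultimately show ?thesis by (simp only:)
qed

lemma central_nonneg: "0 \<le> central m"
  by (simp add: central_def)

text \<open>Two further steps add at least the return probability \<open>central m\<close>, and by
  \<open>central_Suc\<close> the claimed bound grows by exactly that amount.\<close>

lemma walk_abs_even: "2 * real m * central m \<le> walk_abs (2 * m)"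
proof (induction m)
  case (Suc m)
  have "(walk_step ^^ (2 * m)) at_zero 0 = central m"
    using walk_return_prob[of "2 * m" m] by (simp add: central_def power_mult)
  then have "walk_abs (2 * Suc m) \<ge> walk_abs (2 * m) + central m"
    using walk_abs_Suc[of "2 * m"] walk_abs_le_Suc[of "Suc (2 * m)"] by simp
  then show ?case using Suc central_Suc[of m] by (simp add: algebra_simps)
qed (simp add: walk_abs_nonneg)

text \<open>\<open>m * (central m)^2\<close> increases (towards \<open>1 / pi\<close>), so one value
  has to be checked; \<open>m = 6\<close> is the first at which it reaches
  \<open>61 / 200\<close>.\<close>

lemma central_square: "m \<ge> 6 \<Longrightarrow> 61 / 200 \<le> real m * (central m)\<^sup>2"
proof (induction m rule: dec_induct)
  case base
  have "(12 choose 6 :: nat) = 924" by (simp add: numeral_eq_Suc)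
  then show ?case by (simp add: central_def power2_eq_square)
next
  case (step m)
  have "(real (Suc m) * (central (Suc m))\<^sup>2) * (4 * (real m + 1)) = (central (Suc m) * (2 * real m + 2))\<^sup>2"
    by (simp add: power2_eq_square algebra_simps)
  also have "\<dots> = (central m)\<^sup>2 * (2 * real m + 1)\<^sup>2"
    by (simp only: central_Suc power_mult_distrib)
  also have "\<dots> \<ge> (central m)\<^sup>2 * (real m * (4 * (real m + 1)))"
    by (intro mult_left_mono) (auto simp: power2_eq_square algebra_simps)
  finally have "(real m * (central m)\<^sup>2) * (4 * (real m + 1)) \<le> (real (Suc m) * (central (Suc m))\<^sup>2) * (4 * (real m + 1))"
    by (simp add: algebra_simps)
  then have "real m * (central m)\<^sup>2 \<le> real (Suc m) * (central (Suc m))\<^sup>2"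
    by (rule mult_right_le_imp_le) simp
  then show ?case using step.IH by linarith
qed

text \<open>The optimal constant is \<open>sqrt (2 / pi)\<close>; any constant whose square exceeds
  \<open>3 / 5\<close> suffices for the theorem.\<close>

definition walk_const :: real where
  "walk_const = sqrt (61 / 100)"

lemma walk_const: "0 \<le> walk_const" "walk_const \<le> 1" "walk_const\<^sup>2 = 61 / 100"
  by (simp_all add: walk_const_def)

text \<open>The subtracted 4 makes \<open>D < 12\<close> trivial and absorbs the rounding of odd
  \<open>D\<close> to the even number below.\<close>

lemma walk_abs_ge: "walk_const * sqrt (real D) - 4 \<le> walk_abs D"
proof (cases "D < 12")
  case True
  have "sqrt (61 / 100) * sqrt (real D) \<le> 1 * sqrt 16"
    using True by (intro mult_mono real_sqrt_le_mono) auto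
  then show ?thesis using walk_abs_nonneg[of D] by (simp add: walk_const_def)
next
  case False
  define m where "m = D div 2"
  have m: "m \<ge> 6" "2 * m \<le> D" "D \<le> 2 * m + 1" using False by (auto simp: m_def)
  have "sqrt (61 / 100 * (2 * m)) \<le> 2 * real m * central m"
  proof (rule real_le_lsqrt)
    show "0 \<le> 2 * real m * central m" by (simp add: central_nonneg)
    have "4 * real m * (61 / 200) \<le> 4 * real m * (real m * (central m)\<^sup>2)"
      using central_square[OF m(1)] by (intro mult_left_mono) auto
    then show "61 / 100 * (2 * m) \<le> (2 * real m * central m)\<^sup>2"
      by (simp add: power2_eq_square algebra_simps)
  qed
  also have "\<dots> \<le> walk_abs (2 * m)" by (rule walk_abs_even)
  also have "\<dots> \<le> walk_abs D"
    by (rule lift_Suc_mono_le[of walk_abs]) (use walk_abs_le_Suc m in auto)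
  finally have 1: "sqrt (61 / 100) * sqrt (2 * real m) \<le> walk_abs D"
    by (simp only: real_sqrt_mult of_nat_mult of_nat_numeral)
  have "sqrt (real D) \<le> sqrt (2 * real m + 1)" using m by simp
  also have "\<dots> \<le> sqrt (2 * real m) + sqrt 1" by (rule sqrt_add_le_add_sqrt) auto
  finally have "sqrt (61 / 100) * sqrt (real D) \<le> sqrt (61 / 100) * (sqrt (2 * real m) + 1)"
    by (intro mult_left_mono) auto
  moreover have "sqrt (61 / 100) \<le> (1 :: real)" by simp
  ultimately show ?thesis using 1 unfolding distrib_left walk_const_def by linarith
qed

section \<open>Walks with a binomial number of steps\<close>

primrec binomial_avg :: "real \<Rightarrow> nat \<Rightarrow> (nat \<Rightarrow> real) \<Rightarrow> real" where
  "binomial_avg q 0 G = G 0"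
| "binomial_avg q (Suc m) G = (1 - q) * binomial_avg q m G + q * binomial_avg q m (\<lambda>D. G (Suc D))"

lemma binomial_avg_mono:
  assumes "0 \<le> q" "q \<le> 1" "\<And>D. G D \<le> G' D"
  shows "binomial_avg q m G \<le> binomial_avg q m G'"
  using assms(3) by (induction m arbitrary: G G') (use assms(1,2) in \<open>auto intro!: add_mono mult_left_mono\<close>)

lemma binomial_avg_quadratic:
  "binomial_avg q m (\<lambda>D. a + b * real D + c * (real D)\<^sup>2)
    = a + b * (m * q) + c * (m * q * (1 - q) + (m * q)\<^sup>2)"
proof (induction m arbitrary: a b c)
  case (Suc m)
  have "(\<lambda>D. a + b * real (Suc D) + c * (real (Suc D))\<^sup>2) =
      (\<lambda>D. (a + b + c) + (b + 2 * c) * real D + c * (real D)\<^sup>2)"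
    by (auto simp: power2_eq_square algebra_simps)
  then show ?case
    unfolding binomial_avg.simps Suc.IH by (simp only: Suc.IH) (simp add: power2_eq_square algebra_simps)
qed simp

text \<open>With \<open>s = sqrt (t / u)\<close> the gap is
  \<open>sqrt u * s (s - 1)^2 (s + 2) / 2\<close>; the parabola touches the root at
  \<open>t = u\<close>. For the mean of a square root Jensen points the wrong way, whereas the mean
  of a quadratic minorant needs only two moments.\<close>

lemma sqrt_ge_parabola:
  fixes u t :: real
  assumes "0 < u" "0 \<le> t"
  shows "sqrt u * (3 / 2 * (t / u) - (t / u)\<^sup>2 / 2) \<le> sqrt t"
proof -
  define s where "s = sqrt (t / u)"
  have s: "0 \<le> s" "s\<^sup>2 = t / u" using assms by (auto simp: s_def)
  have "0 \<le> s * ((s - 1)\<^sup>2 * (s + 2)) / 2" using s by simp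
  also have "\<dots> = s - (3 / 2 * s\<^sup>2 - (s\<^sup>2)\<^sup>2 / 2)"
    by (simp add: power2_eq_square algebra_simps) (simp add: field_simps)
  finally have "3 / 2 * (t / u) - (t / u)\<^sup>2 / 2 \<le> s" by (simp add: s)
  then have "sqrt u * (3 / 2 * (t / u) - (t / u)\<^sup>2 / 2) \<le> sqrt u * s"
    using assms by (intro mult_left_mono) auto
  also have "\<dots> = sqrt t" using assms by (simp add: s_def real_sqrt_divide)
  finally show ?thesis .
qed

lemma binomial_avg_walk_abs_ge:
  assumes "0 \<le> q" "q \<le> 1" "1 \<le> m * q"
  shows "walk_const * sqrt (m * q) - 5 \<le> binomial_avg q m walk_abs"
proof -
  define u where "u = m * q"
  define K where "K = walk_const"
  have K: "0 \<le> K" "K \<le> 1" using walk_const by (auto simp: K_def)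
  have u: "1 \<le> u" using assms by (simp add: u_def)
  have "-4 + K * sqrt u * (3 / 2 / u) * real D + - (K * sqrt u / (2 * u\<^sup>2)) * (real D)\<^sup>2 \<le> walk_abs D" for D
  proof -
    have "K * (sqrt u * (3 / 2 * (real D / u) - (real D / u)\<^sup>2 / 2)) \<le> K * sqrt (real D)"
      using K u by (intro mult_left_mono sqrt_ge_parabola) auto
    also have "\<dots> \<le> walk_abs D + 4" using walk_abs_ge[of D] by (simp add: K_def)
    finally show ?thesis by (simp add: algebra_simps power_divide)
  qed
  then have "binomial_avg q m (\<lambda>D. -4 + K * sqrt u * (3 / 2 / u) * real D + - (K * sqrt u / (2 * u\<^sup>2)) * (real D)\<^sup>2)
     \<le> binomial_avg q m walk_abs"
    by (intro binomial_avg_mono assms)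
  then have "-4 + K * sqrt u * (3 / 2 / u) * u - (K * sqrt u / (2 * u\<^sup>2)) * (u * (1 - q) + u\<^sup>2)
     \<le> binomial_avg q m walk_abs"
    unfolding binomial_avg_quadratic u_def[symmetric] by simp
  moreover have "K * sqrt u * (3 / 2 / u) * u = 3 / 2 * (K * sqrt u)" using u by simp
  \<comment> \<open>The second moment is \<open>u^2\<close> plus the variance
    \<open>u (1 - q)\<close>. As \<open>u \<ge> 1\<close>, the variance part costs at most 1, which
    turns the 4 of \<open>walk_abs_ge\<close> into 5.\<close>
  moreover have "(K * sqrt u / (2 * u\<^sup>2)) * (u * (1 - q) + u\<^sup>2) \<le> 1 / 2 * (K * sqrt u) + 1"
  proof -
    have "(K * sqrt u / (2 * u\<^sup>2)) * (u * (1 - q) + u\<^sup>2) = 1 / 2 * (K * sqrt u) + K * (sqrt u / u) * (1 - q) / 2"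
      using u by (simp add: field_simps power2_eq_square)
    moreover have "sqrt u / u \<le> 1"
      using u real_le_lsqrt[of u u] by (simp add: power2_eq_square)
    then have "K * (sqrt u / u) * (1 - q) \<le> 1 * 1 * 1"
      using K u assms by (intro mult_mono) auto
    then have "K * (sqrt u / u) * (1 - q) / 2 \<le> 1" by simp
    ultimately show ?thesis by (simp only: add_left_mono)
  qed
  ultimately show ?thesis by (simp add: K_def u_def)
qed

text \<open>A step is zero with probability \<open>1 - q\<close> and a fair sign otherwise, so only
  a binomial number of the \<open>m\<close> steps move the walk.\<close>

lemma avg_lazy_walk:
  fixes d :: "'a \<Rightarrow> int"
  assumes step: "\<And>g. avg S (\<lambda>s. g (d s)) = (1 - q) * g 0 + q * ((g 1 + g (- 1)) / 2)"
  shows "avg (seqs S m) (\<lambda>F. f (\<Sum>s\<leftarrow>F. d s)) = binomial_avg q m (\<lambda>D. (walk_step ^^ D) f 0)"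
proof (induction m arbitrary: f)
  case (Suc m)
  have "avg (seqs S (Suc m)) (\<lambda>F. f (\<Sum>s\<leftarrow>F. d s)) = avg (seqs S m) (\<lambda>F. avg S (\<lambda>s. f (d s + (\<Sum>s\<leftarrow>F. d s))))"
    by (simp add: avg_seqs_Suc avg_swap[of S])
  also have "\<dots> = avg (seqs S m) (\<lambda>F. (1 - q) * f (\<Sum>s\<leftarrow>F. d s) + q * walk_step f (\<Sum>s\<leftarrow>F. d s))"
    by (intro avg_cong) (simp add: step[of "\<lambda>e. f (e + _)"] walk_step_def add.commute)
  finally show ?case
    by (simp add: avg_add avg_cmult Suc.IH funpow_Suc_right o_def del: funpow.simps)
qed simp

subsection \<open>Clauses and noise sensitivity\<close>

lemma cube_eq_seqs: "cube k = seqs UNIV k"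
  by (simp add: cube_def seqs_def)

lemma finite_cube [simp]: "finite (cube k)"
  by (simp add: cube_eq_seqs)

lemma cube_nonempty [simp]: "cube k \<noteq> {}"
  by (simp add: cube_eq_seqs)

lemma card_cube: "card (cube k) = 2 ^ k"
  by (simp add: cube_eq_seqs card_seqs UNIV_bool numeral_2_eq_2)

text \<open>\<open>halfsum\<close> and \<open>halfdiff\<close> are the parts of \<open>G\<close>
  whose Fourier characters omit, respectively contain, the first bit. Splitting bit by bit replaces
  the full Fourier expansion, so the noise estimates are inductions on \<open>k\<close>.\<close>

definition halfsum :: "(bool list \<Rightarrow> real) \<Rightarrow> bool list \<Rightarrow> real" where
  "halfsum G z = (G (True # z) + G (False # z)) / 2"

definition halfdiff :: "(bool list \<Rightarrow> real) \<Rightarrow> bool list \<Rightarrow> real" where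
  "halfdiff G z = (G (True # z) - G (False # z)) / 2"

text \<open>\<open>noise_form d k G H\<close> is the expectation of \<open>G z * H z'\<close> for uniform \<open>z\<close> and \<open>z'\<close> obtained from
  \<open>z\<close> by flipping each of the \<open>k\<close> bits independently with probability \<open>d\<close>.\<close>

primrec noise_form :: "real \<Rightarrow> nat \<Rightarrow> (bool list \<Rightarrow> real) \<Rightarrow> (bool list \<Rightarrow> real) \<Rightarrow> real" where
  "noise_form d 0 G H = G [] * H []"
| "noise_form d (Suc k) G H = (1 - d) *
     ((noise_form d k (\<lambda>z. G (True # z)) (\<lambda>z. H (True # z)) + noise_form d k (\<lambda>z. G (False # z)) (\<lambda>z. H (False # z))) / 2)
   + d * ((noise_form d k (\<lambda>z. G (True # z)) (\<lambda>z. H (False # z)) + noise_form d k (\<lambda>z. G (False # z)) (\<lambda>z. H (True # z))) / 2)"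

lemma noise_form_lin_left:
  "noise_form d k (\<lambda>z. a * G z + b * G' z) H = a * noise_form d k G H + b * noise_form d k G' H"
  by (induction k arbitrary: G G' H) (simp_all, simp_all add: field_simps)

lemma noise_form_sym: "noise_form d k G H = noise_form d k H G"
  by (induction k arbitrary: G H) (simp_all add: algebra_simps)

lemma noise_form_lin_right:
  "noise_form d k H (\<lambda>z. a * G z + b * G' z) = a * noise_form d k H G + b * noise_form d k H G'"
  by (subst (1 2 3) noise_form_sym) (rule noise_form_lin_left)

text \<open>Flipping the first bit fixes the \<open>halfsum\<close> part and negates the
  \<open>halfdiff\<close> part; the cross terms cancel and the latter gets the factor
  \<open>(1 - d) - d\<close>.\<close>

lemma noise_form_Suc_diag:
  "noise_form d (Suc k) G G = noise_form d k (halfsum G) (halfsum G)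
     + (1 - 2 * d) * noise_form d k (halfdiff G) (halfdiff G)"
proof -
  have u: "halfsum G = (\<lambda>z. 1 / 2 * G (True # z) + 1 / 2 * G (False # z))"
    by (auto simp: halfsum_def)
  have v: "halfdiff G = (\<lambda>z. 1 / 2 * G (True # z) + (- 1 / 2) * G (False # z))"
    by (auto simp: halfdiff_def diff_divide_distrib)
  show ?thesis
    unfolding u v noise_form_lin_left noise_form_lin_right by (simp add: field_simps)
qed

lemma noise_form_0_nonneg: "0 \<le> noise_form 0 k G G"
  by (induction k arbitrary: G) auto

lemma abs_noise_form_le:
  assumes "0 \<le> d" "d \<le> 1"
  shows "\<bar>noise_form d k G G\<bar> \<le> noise_form 0 k G G"
proof (induction k arbitrary: G)
  case (Suc k)
  have "\<bar>(1 - 2 * d) * noise_form d k (halfdiff G) (halfdiff G)\<bar> \<le> 1 * noise_form 0 k (halfdiff G) (halfdiff G)"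
    unfolding abs_mult using assms Suc.IH[of "halfdiff G"] by (intro mult_mono) auto
  then show ?case
    using Suc.IH[of "halfsum G"] unfolding noise_form_Suc_diag by simp
qed simp

text \<open>The eigenvalues \<open>(1 - 2 d)^s\<close> are nonnegative for
  \<open>d \<le> 1 / 2\<close>. Beyond that the most negative one is that of \<open>s = 1\<close>,
  because \<open>\<bar>1 - 2 d\<bar> \<le> 1\<close>.\<close>

lemma noise_form_ge:
  assumes "0 \<le> d" "d \<le> 1"
  shows "min 0 (1 - 2 * d) * noise_form 0 k G G \<le> noise_form d k G G"
proof (induction k arbitrary: G)
  case 0
  have "min 0 (1 - 2 * d) * (G [] * G []) \<le> 0"
    by (intro mult_nonpos_nonneg) auto
  also have "\<dots> \<le> G [] * G []" by simp
  finally show ?case by simp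
next
  case (Suc k)
  let ?v = "halfdiff G" and ?u = "halfsum G"
  have "min 0 (1 - 2 * d) * noise_form 0 k ?v ?v \<le> (1 - 2 * d) * noise_form d k ?v ?v"
  proof (cases "1 - 2 * d \<ge> 0")
    case True
    then show ?thesis using Suc.IH[of ?v] by simp
  next
    case False
    then show ?thesis
      using abs_noise_form_le[OF assms, of k ?v] by (auto intro: mult_left_mono_neg)
  qed
  then show ?case
    using Suc.IH[of ?u] unfolding noise_form_Suc_diag by (simp add: algebra_simps)
qed

text \<open>In Fourier terms: \<open>(1 - 2d)^s \<le> 1 - 4d/3\<close> for all \<open>s \<ge> 1\<close> if \<open>d \<le> 2/3\<close>. Beyond
  \<open>d = 2/3\<close> this fails for \<open>s = 2\<close>.\<close>

lemma noise_form_le: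
  assumes "0 \<le> d" "d \<le> 2 / 3"
  shows "noise_form d k G G \<le> (1 - 4 / 3 * d) * noise_form 0 k G G + 4 / 3 * d * noise_form (1 / 2) k G G"
proof (induction k arbitrary: G)
  case 0
  then show ?case by (simp add: algebra_simps)
next
  case (Suc k)
  let ?v = "halfdiff G" and ?u = "halfsum G"
  have N: "0 \<le> noise_form 0 k ?v ?v" by (rule noise_form_0_nonneg)
  have "(1 - 2 * d) * noise_form d k ?v ?v \<le> (1 - 4 / 3 * d) * noise_form 0 k ?v ?v"
  proof (cases "1 - 2 * d \<ge> 0")
    case True
    then have "(1 - 2 * d) * noise_form d k ?v ?v \<le> (1 - 2 * d) * noise_form 0 k ?v ?v"
      using abs_noise_form_le[of d k ?v] assms by (intro mult_left_mono) auto
    also have "\<dots> \<le> (1 - 4 / 3 * d) * noise_form 0 k ?v ?v"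
      using N assms by (intro mult_right_mono) auto
    finally show ?thesis .
  next
    case False
    \<comment> \<open>A negative factor calls for the lower bound on the form. This produces
      \<open>(1 - 2 d)^2\<close>, the eigenvalue of level 2, and is where
      \<open>d \<le> 2 / 3\<close> is needed.\<close>
    then have "(1 - 2 * d) * noise_form d k ?v ?v \<le> (1 - 2 * d) * ((1 - 2 * d) * noise_form 0 k ?v ?v)"
      using noise_form_ge[of d k ?v] assms by (intro mult_left_mono_neg) auto
    also have "\<dots> = (1 - 2 * d)\<^sup>2 * noise_form 0 k ?v ?v" by (simp add: power2_eq_square)
    also have "\<dots> \<le> (1 - 4 / 3 * d) * noise_form 0 k ?v ?v"
    proof (rule mult_right_mono[OF _ N])
      have "0 \<le> 4 * d * (2 / 3 - d)" using assms by simp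
      then show "(1 - 2 * d)\<^sup>2 \<le> 1 - 4 / 3 * d" by (simp add: power2_eq_square algebra_simps)
    qed
    finally show ?thesis .
  qed
  then show ?case
    using Suc.IH[of ?u] unfolding noise_form_Suc_diag by (simp add: algebra_simps)
qed

lemma noise_form_0_eq: "noise_form 0 k G H = avg (cube k) (\<lambda>z. G z * H z)"
  unfolding cube_eq_seqs
  by (induction k arbitrary: G H) (simp_all add: avg_seqs_Suc avg_UNIV_bool)

text \<open>Noise \<open>1 / 2\<close> makes the two points independent: every
  \<open>halfdiff\<close> part is annihilated and only the mean survives.\<close>

lemma noise_form_half_eq: "noise_form (1 / 2) k G G = (avg (cube k) G)\<^sup>2"
  unfolding cube_eq_seqs
proof (induction k arbitrary: G)
  case (Suc k)
  have "noise_form (1 / 2) (Suc k) G G = (avg (seqs UNIV k) (halfsum G))\<^sup>2"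
    unfolding noise_form_Suc_diag Suc.IH by simp
  then show ?case
    by (simp add: halfsum_def[abs_def] avg_seqs_Suc avg_UNIV_bool avg_add avg_divide)
qed (simp add: power2_eq_square)

section \<open>Random clauses at a pair of assignments\<close>

definition dist_frac :: "nat \<Rightarrow> (nat \<Rightarrow> bool) \<Rightarrow> (nat \<Rightarrow> bool) \<Rightarrow> real" where
  "dist_frac n x y = avg {1..n} (\<lambda>j. of_bool (x j \<noteq> y j))"

definition shifted :: "(nat \<Rightarrow> bool) \<Rightarrow> nat list \<Rightarrow> bool list \<Rightarrow> bool list" where
  "shifted x is \<sigma> = map2 (\<noteq>) (map x is) \<sigma>"

lemma satisfies_eq: "satisfies g x (is, \<sigma>) = g (shifted x is \<sigma>)"
  by (simp add: satisfies_def shifted_def)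

lemma shifted_simps [simp]:
  "shifted x [] \<sigma> = []" "shifted x (i # is) (s # \<sigma>) = (x i \<noteq> s) # shifted x is \<sigma>"
  by (simp_all add: shifted_def)

lemma shifted_shifted:
  "length is = length \<sigma> \<Longrightarrow> shifted x is (shifted x is \<sigma>) = \<sigma>"
  by (induction "is" \<sigma> rule: list_induct2) auto

lemma bij_shifted: "length is = k \<Longrightarrow> bij_betw (shifted x is) (cube k) (cube k)"
  by (rule bij_betw_byWitness[where f' = "shifted x is"])
    (auto simp: cube_def shifted_shifted, simp_all add: shifted_def)

text \<open>A uniform sign vector makes the point seen from \<open>x\<close> uniform, and the one
  seen from \<open>y\<close> differs from it exactly at the positions whose index separates
  \<open>x\<close> and \<open>y\<close>. These events are independent with probability
  \<open>dist_frac n x y\<close> only if indices are drawn with repetition, hence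
  \<open>seqs\<close> instead of distinct tuples.\<close>

lemma avg_noise_form:
  assumes n: "n \<ge> 1"
  shows "avg (seqs {1..n} k) (\<lambda>is. avg (cube k) (\<lambda>\<sigma>. G (shifted x is \<sigma>) * H (shifted y is \<sigma>)))
    = noise_form (dist_frac n x y) k G H"
  unfolding cube_eq_seqs
proof (induction k arbitrary: G H)
  case (Suc k)
  define d where "d = dist_frac n x y"
  define E where "E s t = noise_form d k (\<lambda>z. G (s # z)) (\<lambda>z. H (t # z))" for s t
  have "avg (seqs {1..n} (Suc k)) (\<lambda>is. avg (seqs UNIV (Suc k)) (\<lambda>\<sigma>. G (shifted x is \<sigma>) * H (shifted y is \<sigma>)))
     = avg {1..n} (\<lambda>i. avg UNIV (\<lambda>s. avg (seqs {1..n} k) (\<lambda>is. avg (seqs UNIV k)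
         (\<lambda>\<sigma>. G ((x i \<noteq> s) # shifted x is \<sigma>) * H ((y i \<noteq> s) # shifted y is \<sigma>)))))"
    by (simp add: avg_seqs_Suc avg_swap[of UNIV])
  also have "\<dots> = avg {1..n} (\<lambda>i. avg UNIV (\<lambda>s. E (x i \<noteq> s) (y i \<noteq> s)))"
    unfolding E_def d_def Suc.IH[symmetric] ..
  also have "\<dots> = avg {1..n} (\<lambda>i. (1 - of_bool (x i \<noteq> y i)) * ((E True True + E False False) / 2)
      + of_bool (x i \<noteq> y i) * ((E True False + E False True) / 2))"
    by (intro avg_cong) (auto simp: avg_UNIV_bool)
  also have "\<dots> = (1 - d) * ((E True True + E False False) / 2) + d * ((E True False + E False True) / 2)"
    using n by (simp only: avg_add avg_cmult_right avg_diff) (simp add: avg_const d_def dist_frac_def)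
  finally show ?case by (simp add: E_def d_def)
qed simp

definition tuples :: "nat \<Rightarrow> nat \<Rightarrow> nat list set" where
  "tuples k n = {is. length is = k \<and> distinct is \<and> set is \<subseteq> {1..n}}"

lemma clauses_eq: "clauses k n = tuples k n \<times> cube k"
  by (simp add: clauses_def tuples_def)

lemma tuples_subset: "tuples k n \<subseteq> seqs {1..n} k"
  by (auto simp: tuples_def seqs_def)

lemma finite_tuples [simp]: "finite (tuples k n)"
  by (rule finite_subset[OF tuples_subset]) simp

lemma tuples_nonempty: "k \<le> n \<Longrightarrow> tuples k n \<noteq> {}"
proof -
  assume "k \<le> n"
  then have "[1..<Suc k] \<in> tuples k n" by (auto simp: tuples_def)
  then show ?thesis by blast
qed

text \<open>The probability that \<open>k\<close> independent uniform indices are not all distinct: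
  the error of replacing clauses by independent indices.\<close>

definition repeat_frac :: "nat \<Rightarrow> nat \<Rightarrow> real" where
  "repeat_frac k n = 1 - card (tuples k n) / real n ^ k"

lemma repeat_frac_tendsto: "(\<lambda>n. repeat_frac k n) \<longlonglongrightarrow> 0"
proof -
  have ev: "\<forall>\<^sub>F n in sequentially. (\<Prod>i<k. 1 - real i / real n) = card (tuples k n) / real n ^ k"
    using eventually_ge_at_top[of "max 1 k"]
  proof eventually_elim
    case (elim n)
    have "card (tuples k n) = \<Prod>{n - k + 1..n}"
      unfolding tuples_def using card_lists_distinct_length_eq[of "{1..n}" k] elim by simp
    also have "\<dots> = (\<Prod>i<k. n - i)"
      by (rule prod.reindex_bij_witness[of _ "\<lambda>i. n - i" "\<lambda>i. n - i"]) (use elim in auto)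
    finally have "real (card (tuples k n)) = (\<Prod>i<k. real n - real i)"
      using elim by (simp add: of_nat_diff)
    then have "card (tuples k n) / real n ^ k = (\<Prod>i<k. (real n - real i) / real n)"
      by (simp add: prod_dividef)
    also have "\<dots> = (\<Prod>i<k. 1 - real i / real n)"
      using elim by (intro prod.cong) (auto simp: diff_divide_distrib)
    finally show ?case by simp
  qed
  have "(\<lambda>n. \<Prod>i<k. 1 - real i / real n) \<longlonglongrightarrow> (\<Prod>i<k. 1 - 0)"
    by (intro tendsto_intros tendsto_prod lim_const_over_n)
  then have "(\<lambda>n. card (tuples k n) / real n ^ k) \<longlonglongrightarrow> 1"
    using Lim_transform_eventually[OF _ ev] by simp
  then have "(\<lambda>n. 1 - card (tuples k n) / real n ^ k) \<longlonglongrightarrow> 1 - 1"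
    by (intro tendsto_intros)
  then show ?thesis by (simp add: repeat_frac_def[abs_def])
qed

lemma avg_tuples_ge:
  assumes k: "k \<le> n" "1 \<le> n" and f: "\<And>is. 0 \<le> f is" "\<And>is. f is \<le> 1"
  shows "avg (seqs {1..n} k) f - repeat_frac k n \<le> avg (tuples k n) f"
proof -
  let ?N = "real n ^ k" and ?T = "real (card (tuples k n))"
  have N: "real (card (seqs {1..n} k)) = ?N" by (simp add: card_seqs)
  have T: "0 < ?T" using tuples_nonempty[OF k(1)] by (simp add: card_gt_0_iff)
  have TN: "?T \<le> ?N" unfolding N[symmetric] using tuples_subset by (simp add: card_mono)
  have "(\<Sum>is\<in>seqs {1..n} k. f is) = (\<Sum>is\<in>tuples k n. f is) + (\<Sum>is\<in>seqs {1..n} k - tuples k n. f is)"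
    using sum.subset_diff[OF tuples_subset, where g = f] by simp
  also have "(\<Sum>is\<in>seqs {1..n} k - tuples k n. f is) \<le> (\<Sum>is\<in>seqs {1..n} k - tuples k n. 1)"
    using f by (intro sum_mono)
  also have "\<dots> = ?N - ?T"
    using card_Diff_subset[OF finite_tuples tuples_subset[of k n]] TN N
    by (simp add: of_nat_diff)
  finally have "(\<Sum>is\<in>seqs {1..n} k. f is) / ?N \<le> ((\<Sum>is\<in>tuples k n. f is) + (?N - ?T)) / ?N"
    by (intro divide_right_mono) auto
  also have "\<dots> = (\<Sum>is\<in>tuples k n. f is) / ?N + (1 - ?T / ?N)"
    using k by (simp add: field_simps)
  also have "(\<Sum>is\<in>tuples k n. f is) / ?N \<le> (\<Sum>is\<in>tuples k n. f is) / ?T"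
    using T TN f k by (intro divide_left_mono sum_nonneg mult_pos_pos zero_less_power) auto
  finally show ?thesis unfolding avg_def N repeat_frac_def by linarith
qed

lemma avg_satisfies:
  assumes "k \<le> n"
  shows "avg (clauses k n) (\<lambda>C. of_bool (satisfies g x C)) = avg (cube k) (\<lambda>z. of_bool (g z))"
proof -
  have "avg (clauses k n) (\<lambda>C. of_bool (satisfies g x C)) =
      avg (tuples k n) (\<lambda>is. avg (cube k) (\<lambda>\<sigma>. of_bool (g (shifted x is \<sigma>))))"
    by (simp add: clauses_eq avg_Times satisfies_eq)
  also have "\<dots> = avg (tuples k n) (\<lambda>is. avg (cube k) (\<lambda>z. of_bool (g z)))"
  proof (rule avg_cong)
    fix "is" assume "is \<in> tuples k n"
    then have "bij_betw (shifted x is) (cube k) (cube k)"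
      by (intro bij_shifted) (simp add: tuples_def)
    then show "avg (cube k) (\<lambda>\<sigma>. of_bool (g (shifted x is \<sigma>))) = avg (cube k) (\<lambda>z. of_bool (g z))"
      by (rule avg_bij)
  qed
  also have "\<dots> = avg (cube k) (\<lambda>z. of_bool (g z))"
    using assms by (simp add: avg_const tuples_nonempty)
  finally show ?thesis .
qed

subsection \<open>Upper bound\<close>

lemma finite_assignments [simp]: "finite (assignments n)"
  by (simp add: assignments_def finite_PiE)

lemma card_assignments: "card (assignments n) = 2 ^ n"
  by (simp add: assignments_def card_PiE)

lemma assignments_nonempty [simp]: "assignments n \<noteq> {}"
  by (simp add: assignments_def PiE_eq_empty_iff)

lemma num_sat_eq: "real (num_sat g x F) = (\<Sum>C\<leftarrow>F. of_bool (satisfies g x C))"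
  by (induction F) (auto simp: num_sat_def)

lemma num_sat_le_max_sat: "x \<in> assignments n \<Longrightarrow> num_sat g x F \<le> max_sat g n F"
  unfolding max_sat_def by (intro Max_ge) auto

lemma max_sat_attained:
  obtains x where "x \<in> assignments n" "max_sat g n F = num_sat g x F"
proof -
  have "max_sat g n F \<in> (\<lambda>x. num_sat g x F) ` assignments n"
    unfolding max_sat_def by (intro Max_in) auto
  then show ?thesis using that by auto
qed

lemma finite_clauses [simp]: "finite (clauses k n)"
  by (simp add: clauses_eq)

lemma clauses_nonempty: "k \<le> n \<Longrightarrow> clauses k n \<noteq> {}"
  by (simp add: clauses_eq tuples_nonempty)

lemma expected_max_eq:
  "k \<le> n \<Longrightarrow> expected_max k g n m = avg (seqs (clauses k n) m) (\<lambda>F. real (max_sat g n F))"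
  by (simp add: expected_max_def random_formula_def replicate_pmf_of_set clauses_nonempty)

section \<open>Flipping one variable per block\<close>

definition flip_choices :: "nat \<Rightarrow> nat \<Rightarrow> (nat \<Rightarrow> nat) set" where
  "flip_choices r n = {..<n div r} \<rightarrow>\<^sub>E {..<r}"

text \<open>The variables are divided into \<open>n div r\<close> blocks of length \<open>r\<close>; in each block the one
  selected by \<open>\<phi>\<close> is flipped.\<close>

definition block_flip :: "nat \<Rightarrow> nat \<Rightarrow> (nat \<Rightarrow> nat) \<Rightarrow> (nat \<Rightarrow> bool) \<Rightarrow> nat \<Rightarrow> bool" where
  "block_flip r n \<phi> x = (\<lambda>i\<in>{1..n}.
     x i \<noteq> ((i - 1) div r < n div r \<and> \<phi> ((i - 1) div r) = (i - 1) mod r))"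

lemma block_flip_in_assignments: "block_flip r n \<phi> x \<in> assignments n"
  by (simp add: block_flip_def assignments_def)

lemma finite_flip_choices [simp]: "finite (flip_choices r n)"
  by (simp add: flip_choices_def finite_PiE)

lemma card_flip_choices: "card (flip_choices r n) = r ^ (n div r)"
  by (simp add: flip_choices_def card_PiE)

lemma flip_choices_nonempty: "r \<ge> 1 \<Longrightarrow> flip_choices r n \<noteq> {}"
  by (auto simp: flip_choices_def PiE_eq_empty_iff lessThan_empty_iff)

lemma inj_block_flip: "inj_on (\<lambda>\<phi>. block_flip r n \<phi> x) (flip_choices r n)"
proof (rule inj_onI)
  fix \<phi> \<psi> assume \<phi>: "\<phi> \<in> flip_choices r n" and \<psi>: "\<psi> \<in> flip_choices r n"
    and eq: "block_flip r n \<phi> x = block_flip r n \<psi> x"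
  show "\<phi> = \<psi>"
  proof (rule PiE_ext[OF \<phi>[unfolded flip_choices_def] \<psi>[unfolded flip_choices_def]])
    fix b assume b: "b \<in> {..<n div r}"
    \<comment> \<open>The variable flipped by \<open>\<phi>\<close> in block \<open>b\<close>;
      \<open>Suc\<close> because variables are numbered from 1.\<close>
    define i where "i = Suc (b * r + \<phi> b)"
    have v: "\<phi> b < r" using \<phi> b by (auto simp: flip_choices_def)
    have "b * r + \<phi> b < Suc b * r" using v by simp
    also have "\<dots> \<le> (n div r) * r" using b by (intro mult_right_mono) auto
    also have "\<dots> \<le> n" by simp
    finally have i: "i \<in> {1..n}" by (simp add: i_def)
    have d: "(i - 1) div r = b" "(i - 1) mod r = \<phi> b" using v by (auto simp: i_def)
    have "block_flip r n \<phi> x i = block_flip r n \<psi> x i" using eq by simp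
    then show "\<phi> b = \<psi> b" using i d b by (auto simp: block_flip_def)
  qed
qed

lemma avg_flip_choice:
  assumes b: "b < n div r" and v: "v < r"
  shows "avg (flip_choices r n) (\<lambda>\<phi>. of_bool (\<phi> b = v)) = 1 / real r"
proof -
  have eq: "flip_choices r n \<inter> {\<phi>. \<phi> b = v} = PiE {..<n div r} (\<lambda>a. if a = b then {v} else {..<r})"
  proof (intro equalityI subsetI)
    fix \<phi> assume "\<phi> \<in> flip_choices r n \<inter> {\<phi>. \<phi> b = v}"
    then show "\<phi> \<in> PiE {..<n div r} (\<lambda>a. if a = b then {v} else {..<r})"
      by (intro PiE_I) (auto simp: flip_choices_def PiE_def extensional_def)
  next
    fix \<phi> assume \<phi>: "\<phi> \<in> PiE {..<n div r} (\<lambda>a. if a = b then {v} else {..<r})"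
    have *: "\<phi> a \<in> (if a = b then {v} else {..<r})" if "a < n div r" for a
      using PiE_mem[OF \<phi>, of a] that by simp
    have "\<phi> a < r" if "a < n div r" for a
      using *[OF that] v by (cases "a = b") auto
    moreover have "\<phi> a = undefined" if "\<not> a < n div r" for a
      using PiE_arb[OF \<phi>, of a] that by simp
    ultimately have "\<phi> \<in> flip_choices r n"
      unfolding flip_choices_def by (intro PiE_I) auto
    then show "\<phi> \<in> flip_choices r n \<inter> {\<phi>. \<phi> b = v}"
      using *[OF b] by simp
  qed
  have "card (flip_choices r n \<inter> {\<phi>. \<phi> b = v}) = (\<Prod>a<n div r. card (if a = b then {v} else {..<r}))"
    unfolding eq by (simp add: card_PiE)
  also have "\<dots> = (\<Prod>a\<in>{..<n div r} - {b}. r)"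
    using b by (subst prod.remove[of _ b]) (auto intro!: prod.cong)
  also have "\<dots> = r ^ (n div r - 1)" using b by simp
  finally have "avg (flip_choices r n) (\<lambda>\<phi>. of_bool (\<phi> b = v)) = real (r ^ (n div r - 1)) / real (r ^ (n div r))"
    by (simp add: avg_def card_flip_choices)
  also have "r ^ (n div r) = r ^ (n div r - 1) * r"
    using b by (metis Suc_pred' mult.commute not_less_zero power_Suc zero_less_iff_neq_zero)
  finally show ?thesis using v by simp
qed

lemma avg_block_flip_le:
  assumes r: "r \<ge> 1" and i: "i \<in> {1..n}"
  shows "avg (flip_choices r n) (\<lambda>\<phi>. of_bool (block_flip r n \<phi> x i \<noteq> x i)) \<le> 1 / real r"
proof (cases "(i - 1) div r < n div r")
  case True
  then show ?thesis
    using avg_flip_choice[OF True, of "(i - 1) mod r"] r i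
    by (simp add: block_flip_def) (smt (verit) avg_cong of_bool_eq_iff)
next
  case False
  then show ?thesis using i by (simp add: block_flip_def avg_def)
qed

text \<open>Union bound: the truth value of a clause can change only if one of its \<open>k\<close>
  variables is flipped, and each is flipped with probability at most \<open>1 / r\<close>.\<close>

lemma avg_flip_change_le:
  assumes r: "r \<ge> 1" and C: "C \<in> clauses k n"
  shows "\<bar>of_bool (satisfies g x C) - avg (flip_choices r n) (\<lambda>\<phi>. of_bool (satisfies g (block_flip r n \<phi> x) C))\<bar>
    \<le> real k / real r"
proof -
  obtain "is" \<sigma> where C_eq: "C = (is, \<sigma>)" by fastforce
  have "is": "length is = k" "distinct is" "set is \<subseteq> {1..n}"
    using C by (auto simp: C_eq clauses_def)
  let ?\<Phi> = "flip_choices r n" and ?y = "\<lambda>\<phi>. block_flip r n \<phi> x"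
  have pw: "\<bar>of_bool (satisfies g x C) - of_bool (satisfies g (?y \<phi>) C)\<bar>
      \<le> (\<Sum>i\<in>set is. of_bool (?y \<phi> i \<noteq> x i) :: real)" for \<phi>
  proof (cases "\<exists>i\<in>set is. ?y \<phi> i \<noteq> x i")
    case True
    then obtain i where i: "i \<in> set is" "?y \<phi> i \<noteq> x i" by blast
    have "(of_bool (?y \<phi> i \<noteq> x i) :: real) \<le> (\<Sum>i\<in>set is. of_bool (?y \<phi> i \<noteq> x i))"
      using i by (intro member_le_sum) auto
    then show ?thesis using i by (auto intro: order_trans[rotated])
  next
    case False
    then have "map (?y \<phi>) is = map x is" by simp
    then have "satisfies g (?y \<phi>) C = satisfies g x C" by (simp only: C_eq satisfies_def prod.case)
    then show ?thesis by (simp add: sum_nonneg)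
  qed
  have "of_bool (satisfies g x C) - avg ?\<Phi> (\<lambda>\<phi>. of_bool (satisfies g (?y \<phi>) C))
      = avg ?\<Phi> (\<lambda>\<phi>. of_bool (satisfies g x C) - of_bool (satisfies g (?y \<phi>) C))"
    using flip_choices_nonempty[OF r] by (simp add: avg_diff avg_const)
  also have "\<bar>\<dots>\<bar> \<le> avg ?\<Phi> (\<lambda>\<phi>. \<bar>of_bool (satisfies g x C) - of_bool (satisfies g (?y \<phi>) C)\<bar>)"
    unfolding avg_def by (simp add: abs_divide divide_right_mono sum_abs)
  also have "\<dots> \<le> avg ?\<Phi> (\<lambda>\<phi>. \<Sum>i\<in>set is. of_bool (?y \<phi> i \<noteq> x i))"
    by (intro avg_mono pw)
  also have "\<dots> = (\<Sum>i\<in>set is. avg ?\<Phi> (\<lambda>\<phi>. of_bool (?y \<phi> i \<noteq> x i)))"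
    by (rule avg_sum)
  also have "\<dots> \<le> (\<Sum>i\<in>set is. 1 / real r)"
    using "is" by (intro sum_mono avg_block_flip_le r) auto
  also have "\<dots> = real k / real r"
    using "is" by (simp add: distinct_card)
  finally show ?thesis .
qed

text \<open>On \<open>[-1/2, 1/2]\<close> the exponential is at most \<open>1 + u + u^2\<close>, and
  the mean kills the linear term.\<close>

lemma avg_exp_le_exp_square:
  assumes S: "finite S" "S \<noteq> {}" and mean: "avg S f = 0" and le: "\<And>s. s \<in> S \<Longrightarrow> \<bar>f s\<bar> \<le> c" and c: "c \<le> 1 / 2"
  shows "avg S (\<lambda>s. exp (f s)) \<le> exp (c\<^sup>2)"
proof -
  have "exp (f s) \<le> 1 + f s + c\<^sup>2" if s: "s \<in> S" for s
  proof -
    have sq: "(f s)\<^sup>2 \<le> c\<^sup>2" using le[OF s] by (simp add: abs_le_square_iff[symmetric])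
    have "\<bar>f s\<bar> ^ 3 = \<bar>f s\<bar> * (f s)\<^sup>2" by (simp add: power3_eq_cube power2_eq_square abs_mult[symmetric])
    also have "\<dots> \<le> 1 * (f s)\<^sup>2" using le[OF s] c by (intro mult_right_mono) auto
    finally have "\<bar>f s\<bar> ^ 3 \<le> (f s)\<^sup>2" by simp
    moreover have "\<bar>exp (f s) - 1 - f s - (f s)\<^sup>2 / 2\<bar> \<le> \<bar>f s\<bar> ^ 3 / 3"
      using le[OF s] c by (intro exp_cubic_bound) auto
    ultimately have "exp (f s) \<le> 1 + f s + (f s)\<^sup>2"
      using zero_le_power2[of "f s"] by linarith
    then show ?thesis using sq by linarith
  qed
  then have "avg S (\<lambda>s. exp (f s)) \<le> avg S (\<lambda>s. 1 + f s + c\<^sup>2)" by (intro avg_mono)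
  also have "\<dots> = 1 + c\<^sup>2" using S mean by (simp add: avg_add avg_const)
  also have "\<dots> \<le> exp (c\<^sup>2)" by (simp add: exp_ge_add_one_self)
  finally show ?thesis .
qed

text \<open>The gain \<open>(n div r) * ln r\<close> over the plain first moment bound comes from the block flips of an
  optimal assignment; the last summand bounds their average loss, with \<open>t\<close> a free parameter.\<close>

lemma expected_max_upper:
  fixes lam t :: real
  assumes k: "k \<le> n" and r: "r \<ge> 1"
    and p: "p = avg (cube k) (\<lambda>z. of_bool (g z))"
    and lam: "0 < lam" "lam \<le> 1 / 4" and t: "0 < t" "t * (real k / real r) \<le> 1 / 2"
  shows "lam * expected_max k g n m \<le> n * ln 2 + m * (lam * p + lam\<^sup>2 / 2 * (p * (1 - p)) + 4 * lam ^ 3)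
     - real (n div r) * ln r + lam / t * (n * ln 2 + m * (t * (real k / real r))\<^sup>2)"
proof -
  let ?S = "clauses k n" and ?X = "assignments n" and ?\<Phi> = "flip_choices r n"
  let ?sat = "\<lambda>C x. of_bool (satisfies g x C) :: real"
  \<comment> \<open>The average loss at clause \<open>C\<close> caused by a random block flip of
    \<open>x\<close>. It has mean zero over \<open>C\<close> because every assignment satisfies a
    random clause with the same probability \<open>p\<close>.\<close>
  define e where "e C x = ?sat C x - avg ?\<Phi> (\<lambda>\<phi>. ?sat C (block_flip r n \<phi> x))" for C x
  have S: "finite ?S" "?S \<noteq> {}" using k by (auto simp: clauses_nonempty)
  have \<Phi>: "finite ?\<Phi>" "?\<Phi> \<noteq> {}" using r by (auto simp: flip_choices_nonempty)
  have mean: "avg ?S (\<lambda>C. ?sat C x) = p" for x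
    unfolding p by (rule avg_satisfies[OF k])
  have emean: "avg ?S (\<lambda>C. e C x) = 0" for x
    unfolding e_def avg_diff avg_swap[of ?S] mean using \<Phi> by (simp add: avg_const)
  have 1: "avg (seqs ?S m) (\<lambda>F. ln (\<Sum>x\<in>?X. exp (\<Sum>C\<leftarrow>F. lam * ?sat C x)))
      \<le> ln (card ?X) + m * (lam * p + lam\<^sup>2 / 2 * (p * (1 - p)) + 4 * lam ^ 3)"
  proof (rule avg_log_partition_le[OF S])
    fix x
    define w :: "clause \<Rightarrow> real" where "w C = 1 / card ?S" for C
    have w: "\<And>C. 0 \<le> w C" "(\<Sum>C\<in>?S. w C) = 1" using S by (auto simp: w_def)
    have wavg: "(\<Sum>C\<in>?S. w C * u C) = avg ?S u" for u
      by (simp add: w_def avg_def sum_divide_distrib)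
    have sq: "(?sat C x)\<^sup>2 = ?sat C x" for C by (simp add: power2_eq_square)
    have "\<bar>ln (\<Sum>C\<in>?S. w C * exp (lam * ?sat C x)) - lam * (\<Sum>C\<in>?S. w C * ?sat C x)
      - lam\<^sup>2 / 2 * ((\<Sum>C\<in>?S. w C * (?sat C x)\<^sup>2) - (\<Sum>C\<in>?S. w C * ?sat C x)\<^sup>2)\<bar> \<le> 4 * lam ^ 3"
      using w lam by (intro cumulant_bound) auto
    then have "ln (avg ?S (\<lambda>C. exp (lam * ?sat C x))) \<le> lam * p + lam\<^sup>2 / 2 * (p * (1 - p)) + 4 * lam ^ 3"
      unfolding wavg sq mean by (simp add: abs_le_iff power2_eq_square algebra_simps)
    moreover have "0 < avg ?S (\<lambda>C. exp (lam * ?sat C x))"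
      unfolding avg_def using S by (intro divide_pos_pos sum_pos) (auto simp: card_gt_0_iff)
    ultimately show "avg ?S (\<lambda>C. exp (lam * ?sat C x)) \<le> exp (lam * p + lam\<^sup>2 / 2 * (p * (1 - p)) + 4 * lam ^ 3)"
      by (metis exp_le_cancel_iff exp_ln)
  qed auto
  \<comment> \<open>The optimal assignment depends on \<open>F\<close>, so its loss is bounded
    uniformly over all assignments, by a second partition function with its own parameter
    \<open>t\<close>.\<close>
  have 2: "avg (seqs ?S m) (\<lambda>F. ln (\<Sum>x\<in>?X. exp (\<Sum>C\<leftarrow>F. t * e C x)))
      \<le> ln (card ?X) + m * (t * (real k / real r))\<^sup>2"
  proof (rule avg_log_partition_le[OF S])
    fix x
    show "avg ?S (\<lambda>C. exp (t * e C x)) \<le> exp ((t * (real k / real r))\<^sup>2)"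
    proof (rule avg_exp_le_exp_square[OF S _ _ t(2)])
      show "avg ?S (\<lambda>C. t * e C x) = 0" by (simp add: avg_cmult emean)
      show "\<bar>t * e C x\<bar> \<le> t * (real k / real r)" if "C \<in> ?S" for C
        unfolding abs_mult e_def using t avg_flip_change_le[OF r that, of g x] by (intro mult_mono) auto
    qed
  qed auto
  have pw: "lam * max_sat g n F + real (n div r) * ln r \<le>
      ln (\<Sum>x\<in>?X. exp (\<Sum>C\<leftarrow>F. lam * ?sat C x)) + lam / t * ln (\<Sum>x\<in>?X. exp (\<Sum>C\<leftarrow>F. t * e C x))" for F
  proof -
    obtain x where x: "x \<in> ?X" "max_sat g n F = num_sat g x F" by (rule max_sat_attained)
    define s where "s y = (\<Sum>C\<leftarrow>F. ?sat C y)" for y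
    have es: "(\<Sum>C\<leftarrow>F. e C x) = s x - avg ?\<Phi> (\<lambda>\<phi>. s (block_flip r n \<phi> x))"
      unfolding s_def by (induction F) (use \<Phi> in \<open>auto simp: e_def avg_const avg_add\<close>)
    have "t * (\<Sum>C\<leftarrow>F. e C x) = ln (exp (\<Sum>C\<leftarrow>F. t * e C x))"
      by (simp add: sum_list_const_mult)
    also have "\<dots> \<le> ln (\<Sum>x\<in>?X. exp (\<Sum>C\<leftarrow>F. t * e C x))"
      using x by (intro ln_mono member_le_sum) auto
    finally have "lam / t * (t * (\<Sum>C\<leftarrow>F. e C x)) \<le> lam / t * ln (\<Sum>x\<in>?X. exp (\<Sum>C\<leftarrow>F. t * e C x))"
      using lam t by (intro mult_left_mono) auto
    then have A: "lam * (\<Sum>C\<leftarrow>F. e C x) \<le> lam / t * ln (\<Sum>x\<in>?X. exp (\<Sum>C\<leftarrow>F. t * e C x))"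
      using t by simp
    \<comment> \<open>Jensen over \<open>\<phi>\<close>: the distinct block flips of
      \<open>x\<close> contribute to the partition function at least their number times the
      exponential of their mean value.\<close>
    have "real (r ^ (n div r)) * exp (lam * avg ?\<Phi> (\<lambda>\<phi>. s (block_flip r n \<phi> x)))
        \<le> real (card ?\<Phi>) * avg ?\<Phi> (\<lambda>\<phi>. exp (lam * s (block_flip r n \<phi> x)))"
      unfolding card_flip_choices by (subst avg_cmult[symmetric], intro mult_left_mono exp_avg_le \<Phi>) auto
    also have "\<dots> = (\<Sum>\<phi>\<in>?\<Phi>. exp (lam * s (block_flip r n \<phi> x)))"
      using \<Phi> by (simp add: avg_def)
    also have "\<dots> = (\<Sum>y\<in>(\<lambda>\<phi>. block_flip r n \<phi> x) ` ?\<Phi>. exp (lam * s y))"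
      by (simp add: sum.reindex[OF inj_block_flip])
    also have "\<dots> \<le> (\<Sum>y\<in>?X. exp (lam * s y))"
      by (intro sum_mono2) (auto simp: block_flip_in_assignments)
    finally have "real (r ^ (n div r)) * exp (lam * avg ?\<Phi> (\<lambda>\<phi>. s (block_flip r n \<phi> x))) \<le> (\<Sum>y\<in>?X. exp (lam * s y))" .
    then have "ln (real (r ^ (n div r)) * exp (lam * avg ?\<Phi> (\<lambda>\<phi>. s (block_flip r n \<phi> x)))) \<le> ln (\<Sum>y\<in>?X. exp (lam * s y))"
      using r by (intro ln_mono) auto
    then have "real (n div r) * ln r + lam * avg ?\<Phi> (\<lambda>\<phi>. s (block_flip r n \<phi> x)) \<le> ln (\<Sum>y\<in>?X. exp (lam * s y))"
      using r by (simp add: ln_mult ln_realpow)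
    moreover have "lam * max_sat g n F = lam * avg ?\<Phi> (\<lambda>\<phi>. s (block_flip r n \<phi> x)) + lam * (\<Sum>C\<leftarrow>F. e C x)"
      unfolding es x(2) num_sat_eq s_def[symmetric] by (simp add: algebra_simps)
    moreover have "(\<Sum>x\<in>?X. exp (\<Sum>C\<leftarrow>F. lam * ?sat C x)) = (\<Sum>y\<in>?X. exp (lam * s y))"
      by (simp add: s_def sum_list_const_mult)
    ultimately show ?thesis using A by (simp only:)
  qed
  have fin: "finite (seqs ?S m)" "seqs ?S m \<noteq> {}" using S by auto
  have "lam * expected_max k g n m + real (n div r) * ln r =
      avg (seqs ?S m) (\<lambda>F. lam * max_sat g n F + real (n div r) * ln r)"
    using fin by (simp add: expected_max_eq[OF k] avg_add avg_cmult avg_const)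
  also have "\<dots> \<le> avg (seqs ?S m) (\<lambda>F. ln (\<Sum>x\<in>?X. exp (\<Sum>C\<leftarrow>F. lam * ?sat C x))
      + lam / t * ln (\<Sum>x\<in>?X. exp (\<Sum>C\<leftarrow>F. t * e C x)))"
    by (intro avg_mono pw)
  also have "\<dots> \<le> (ln (card ?X) + m * (lam * p + lam\<^sup>2 / 2 * (p * (1 - p)) + 4 * lam ^ 3))
      + lam / t * (ln (card ?X) + m * (t * (real k / real r))\<^sup>2)"
    unfolding avg_add avg_cmult using 1 2 lam t by (intro add_mono mult_left_mono) auto
  finally show ?thesis
    by (simp add: card_assignments ln_realpow)
qed

subsection \<open>Comparison with random literals\<close>

definition bsign :: "bool \<Rightarrow> int" where
  "bsign e = (if e then 1 else - 1)"

lemma bsign_simps [simp]: "bsign True = 1" "bsign False = - 1" "bsign (\<not> e) = - bsign e" "\<bar>bsign e\<bar> = 1"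
  "\<bar>real_of_int (bsign e)\<bar> = 1"
  by (simp_all add: bsign_def)

type_synonym literal = "nat \<times> bool"

definition literals :: "nat \<Rightarrow> literal set" where
  "literals n = {1..n} \<times> UNIV"

definition step_on :: "nat set \<Rightarrow> literal \<Rightarrow> int" where
  "step_on J l = (if fst l \<in> J then bsign (snd l) else 0)"

text \<open>Positive minus negative occurrences in \<open>F\<close> of the variables in
  \<open>J\<close>. The linear process at \<open>x\<close> is the sum of these singleton imbalances,
  weighted by the signs of \<open>x\<close>.\<close>

definition imbalance :: "nat set \<Rightarrow> literal list \<Rightarrow> int" where
  "imbalance J F = (\<Sum>l\<leftarrow>F. step_on J l)"

lemma finite_literals [simp]: "finite (literals n)"
  by (simp add: literals_def)

lemma literals_nonempty: "n \<ge> 1 \<Longrightarrow> literals n \<noteq> {}"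
  by (simp add: literals_def)

lemma avg_imbalance:
  assumes n: "n \<ge> 1" and J: "J \<subseteq> {1..n}"
  shows "avg (seqs (literals n) m) (\<lambda>F. f (imbalance J F))
    = binomial_avg (card J / n) m (\<lambda>D. (walk_step ^^ D) f 0)"
  unfolding imbalance_def
proof (rule avg_lazy_walk)
  fix g :: "int \<Rightarrow> real"
  have q: "avg {1..n} (\<lambda>j. of_bool (j \<in> J)) = card J / n"
    using J by (simp add: avg_def Int_absorb1 flip: Int_def)
  have "avg (literals n) (\<lambda>l. g (step_on J l)) =
     avg {1..n} (\<lambda>j. (1 - of_bool (j \<in> J)) * g 0 + of_bool (j \<in> J) * ((g 1 + g (- 1)) / 2))"
    unfolding literals_def avg_Times by (rule avg_cong) (simp add: avg_UNIV_bool step_on_def)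
  also have "\<dots> = (1 - card J / n) * g 0 + card J / n * ((g 1 + g (- 1)) / 2)"
    using n by (simp only: avg_add avg_cmult_right avg_diff q) (simp add: avg_const)
  finally show "avg (literals n) (\<lambda>l. g (step_on J l)) = \<dots>" .
qed

lemma avg_abs_imbalance_ge:
  assumes n: "n \<ge> 1" and J: "J \<subseteq> {1..n}" and m: "1 \<le> m * (card J / n)"
  shows "walk_const * sqrt (m * (card J / n)) - 5
    \<le> avg (seqs (literals n) m) (\<lambda>F. \<bar>real_of_int (imbalance J F)\<bar>)"
proof -
  have "card J \<le> n" using card_mono[OF _ J] by simp
  then have "walk_const * sqrt (m * (card J / n)) - 5 \<le> binomial_avg (card J / n) m walk_abs"
    using n by (intro binomial_avg_walk_abs_ge m) auto
  then show ?thesis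
    unfolding avg_imbalance[OF n J, of m "\<lambda>x. \<bar>real_of_int x\<bar>"] walk_abs_def[abs_def] .
qed

definition flip_on :: "nat set \<Rightarrow> literal \<Rightarrow> literal" where
  "flip_on J l = (fst l, if fst l \<in> J then \<not> snd l else snd l)"

lemma flip_on_flip_on [simp]: "flip_on J (flip_on J l) = l"
  by (cases l) (simp add: flip_on_def)

lemma avg_flip_on: "avg (seqs (literals n) m) (\<lambda>F. f (map (flip_on J) F)) = avg (seqs (literals n) m) f"
proof (rule avg_bij)
  have "flip_on J l \<in> literals n" if "l \<in> literals n" for l
    using that by (auto simp: flip_on_def literals_def)
  then have "map (flip_on J) F \<in> seqs (literals n) m" if "F \<in> seqs (literals n) m" for F
    using that unfolding seqs_def by (auto simp del: split_paired_All)
  then show "bij_betw (map (flip_on J)) (seqs (literals n) m) (seqs (literals n) m)"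
    by (intro bij_betw_byWitness[where f' = "map (flip_on J)"]) (auto simp: o_def)
qed

lemma imbalance_flip_on_subset: "I \<subseteq> J \<Longrightarrow> imbalance I (map (flip_on J) F) = - imbalance I F"
  by (induction F) (auto simp: imbalance_def step_on_def flip_on_def)

lemma imbalance_flip_on_disjoint: "I \<inter> J = {} \<Longrightarrow> imbalance I (map (flip_on J) F) = imbalance I F"
  by (induction F) (auto simp: imbalance_def step_on_def flip_on_def)

lemma imbalance_insert: "i \<notin> J \<Longrightarrow> imbalance (insert i J) F = imbalance {i} F + imbalance J F"
  by (induction F) (auto simp: imbalance_def step_on_def)

lemma avg_imbalance_zero: "avg (seqs (literals n) m) (\<lambda>F. real_of_int (imbalance J F)) = 0"
proof -
  have "avg (seqs (literals n) m) (\<lambda>F. real_of_int (imbalance J F)) =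
      avg (seqs (literals n) m) (\<lambda>F. (- 1) * real_of_int (imbalance J F))"
    by (subst avg_flip_on[of _ _ _ J, symmetric]) (simp add: imbalance_flip_on_subset)
  then show ?thesis by (simp only: avg_cmult)
qed

text \<open>The largest of the four signed sums of \<open>a\<close>, \<open>b\<close>,
  \<open>c\<close> whose signs have product 1, grouped by the sign of \<open>c\<close>.\<close>

definition triple_max :: "real \<Rightarrow> real \<Rightarrow> real \<Rightarrow> real" where
  "triple_max a b c = max (c + \<bar>a + b\<bar>) (\<bar>a - b\<bar> - c)"

lemma triple_max_attained:
  fixes a b c :: real
  obtains s t u where "s = (t = u)" "triple_max a b c = bsign s * a + bsign t * b + bsign u * c"
proof (cases "\<bar>a - b\<bar> - c \<le> c + \<bar>a + b\<bar>")
  case True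
  then show ?thesis
    using that[of "a + b \<ge> 0" "a + b \<ge> 0" True] by (auto simp: triple_max_def max_def bsign_def split: if_splits)
next
  case False
  then show ?thesis
    using that[of "a - b \<ge> 0" "\<not> a - b \<ge> 0" False]
    by (auto simp: triple_max_def max_def bsign_def split: if_splits)
qed

text \<open>Negating all literals of one variable preserves the distribution. So \<open>c\<close>
  may be replaced by \<open>- c\<close> and \<open>a + b\<close> by \<open>a - b\<close>, and the
  two versions of \<open>triple_max\<close> add up pointwise to at least
  \<open>2 \<bar>c\<bar> + \<bar>a + b\<bar> + \<bar>a - b\<bar>\<close>.\<close>

lemma avg_triple_max:
  assumes "i \<noteq> j" "i \<noteq> l" "j \<noteq> l"
  shows "avg (seqs (literals n) m) (\<lambda>F. \<bar>real_of_int (imbalance {l} F)\<bar>)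
     + avg (seqs (literals n) m) (\<lambda>F. \<bar>real_of_int (imbalance {i, j} F)\<bar>)
    \<le> avg (seqs (literals n) m) (\<lambda>F. triple_max (imbalance {i} F) (imbalance {j} F) (imbalance {l} F))"
    (is "?L + ?IJ \<le> ?T")
proof -
  let ?avg = "avg (seqs (literals n) m)"
  have T: "?T = ?avg (\<lambda>F. triple_max (imbalance {i} F) (imbalance {j} F) (- imbalance {l} F))"
    using assms avg_flip_on[of n m "\<lambda>F. triple_max (imbalance {i} F) (imbalance {j} F) (imbalance {l} F)" "{l}"]
    by (simp add: imbalance_flip_on_subset imbalance_flip_on_disjoint)
  have p: "real_of_int (imbalance {i} F) + imbalance {j} F = imbalance {i, j} F" for F
    using assms by (simp add: imbalance_insert[of i "{j}"])
  have minus: "?avg (\<lambda>F. \<bar>real_of_int (imbalance {i} F) - imbalance {j} F\<bar>) = ?IJ"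
    using assms avg_flip_on[of n m "\<lambda>F. \<bar>real_of_int (imbalance {i} F) - imbalance {j} F\<bar>" "{j}"]
    by (simp add: imbalance_flip_on_subset imbalance_flip_on_disjoint p)
  have "2 * ?L + ?IJ + ?IJ = ?avg (\<lambda>F. 2 * \<bar>real_of_int (imbalance {l} F)\<bar> + \<bar>real_of_int (imbalance {i} F) + imbalance {j} F\<bar>
      + \<bar>real_of_int (imbalance {i} F) - imbalance {j} F\<bar>)"
    by (simp only: avg_add avg_cmult minus p)
  also have "\<dots> \<le> ?avg (\<lambda>F. triple_max (imbalance {i} F) (imbalance {j} F) (imbalance {l} F)
      + triple_max (imbalance {i} F) (imbalance {j} F) (- imbalance {l} F))"
    by (intro avg_mono) (auto simp: triple_max_def max_def)
  also have "\<dots> = 2 * ?T" using T by (simp add: avg_add)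
  finally show ?thesis by simp
qed

lemma sum_triples:
  fixes f :: "nat \<Rightarrow> 'a :: comm_monoid_add"
  shows "(\<Sum>j=1..n. f j) = (\<Sum>l<n div 3. f (3 * l + 1) + f (3 * l + 2) + f (3 * l + 3))
     + (\<Sum>j=3 * (n div 3) + 1..n. f j)"
proof -
  have *: "(\<Sum>j=1..3 * G. f j) = (\<Sum>l<G. f (3 * l + 1) + f (3 * l + 2) + f (3 * l + 3))" for G
    by (induction G) (simp_all add: numeral_3_eq_3 add.assoc)
  have "{1..n} = {1..3 * (n div 3)} \<union> {3 * (n div 3) + 1..n}" by auto
  then have "(\<Sum>j=1..n. f j) = (\<Sum>j=1..3 * (n div 3). f j) + (\<Sum>j=3 * (n div 3) + 1..n. f j)"
    by (simp add: sum.union_disjoint)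
  then show ?thesis by (simp only: *)
qed

lemma linear_sum_eq:
  assumes "F \<in> seqs (literals n) m"
  shows "(\<Sum>l\<leftarrow>F. a * real_of_int (bsign (x (fst l)) * bsign (snd l)))
    = a * (\<Sum>j=1..n. bsign (x j) * real_of_int (imbalance {j} F))"
proof -
  have "(\<Sum>l\<leftarrow>F. a * real_of_int (bsign (x (fst l)) * bsign (snd l)))
    = a * (\<Sum>j=1..n. bsign (x j) * real_of_int (imbalance {j} F))" if "set F \<subseteq> literals n" for F
    using that
  proof (induction F)
    case (Cons l F)
    have "fst l \<in> {1..n}" using Cons.prems by (auto simp: literals_def)
    then have "(\<Sum>j=1..n. bsign (x j) * real_of_int (step_on {j} l)) = real_of_int (bsign (x (fst l)) * bsign (snd l))"
      by (simp add: step_on_def if_distrib[of "\<lambda>u. _ * real_of_int u"] cong: if_cong)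
    then show ?case
      using Cons by (simp add: imbalance_def distrib_left sum.distrib)
  qed (simp add: imbalance_def)
  then show ?thesis using assms by (simp add: seqs_def)
qed

text \<open>The literal process is scaled by \<open>a\<close>. A literal whose variable separates
  \<open>x\<close> and \<open>y\<close> changes by \<open>2 a\<close> in absolute value, so the mean
  squared increment is \<open>4 a^2\<close> times the normalised distance; \<open>sens\<close> asks
  the clauses to dominate it.\<close>

lemma expected_max_lower:
  fixes a b :: real
  assumes k: "k \<le> n" "1 \<le> n" and B: "B \<subseteq> assignments n" "B \<noteq> {}" and a: "0 \<le> a" "a \<le> 1"
    and p: "p = avg (cube k) (\<lambda>z. of_bool (g z))"
    and sens: "\<And>x y. x \<in> B \<Longrightarrow> y \<in> B \<Longrightarrow> 4 * a\<^sup>2 * dist_frac n x y \<le>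
      avg (seqs {1..n} k) (\<lambda>is. avg (cube k)
        (\<lambda>\<sigma>. (of_bool (g (shifted x is \<sigma>)) - of_bool (g (shifted y is \<sigma>)))\<^sup>2))"
    and b: "0 < b" "b \<le> 1 / 4"
    and N: "\<And>F. F \<in> seqs (literals n) m \<Longrightarrow>
      \<exists>x\<in>B. N F \<le> (\<Sum>j=1..n. bsign (x j) * real_of_int (imbalance {j} F))"
  shows "a * avg (seqs (literals n) m) N + m * p - n * ln 2 / b - m * (8 * b\<^sup>2 + b * repeat_frac k n / 4)
    \<le> expected_max k g n m"
proof -
  let ?f = "\<lambda>C x. of_bool (satisfies g x C) :: real"
  let ?h = "\<lambda>l x. a * real_of_int (bsign (x (fst l)) * bsign (snd l))"
  have finB: "finite B" using B by (auto intro: finite_subset)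
  have "avg (seqs (literals n) m) (\<lambda>F. a * N F) + m * p - ln (card B) / b - m * (8 * b\<^sup>2 + b * repeat_frac k n / 4)
    \<le> avg (seqs (clauses k n) m) (\<lambda>F. real (max_sat g n F))"
  proof (rule expected_max_comparison[where f = ?f and h = ?h and B = B])
    show "avg (clauses k n) (\<lambda>C. ?f C x) = p" for x
      unfolding p by (rule avg_satisfies[OF k(1)])
    show "\<bar>?h l x\<bar> \<le> 1" for l x using a by (simp add: abs_mult)
    show "avg (literals n) (\<lambda>l. ?h l x) = 0" for x
      unfolding literals_def avg_Times by (simp add: avg_UNIV_bool) (simp add: avg_def)
    show "\<exists>x\<in>B. a * N F \<le> (\<Sum>l\<leftarrow>F. ?h l x)" if "F \<in> seqs (literals n) m" for F
      using N[OF that] a unfolding linear_sum_eq[OF that] by (auto intro: mult_left_mono)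
    show "(\<Sum>C\<leftarrow>F. ?f C x) \<le> real (max_sat g n F)" if "x \<in> B" for F x
      using num_sat_le_max_sat[of x n g F] B that unfolding num_sat_eq[symmetric] by auto
    show "avg (literals n) (\<lambda>l. (?h l x - ?h l y)\<^sup>2) \<le> avg (clauses k n) (\<lambda>C. (?f C x - ?f C y)\<^sup>2) + repeat_frac k n"
      if xy: "x \<in> B" "y \<in> B" for x y
    proof -
      have "avg (literals n) (\<lambda>l. (?h l x - ?h l y)\<^sup>2) = avg {1..n} (\<lambda>j. 4 * a\<^sup>2 * of_bool (x j \<noteq> y j))"
        unfolding literals_def avg_Times
        by (rule avg_cong) (auto simp: avg_UNIV_bool bsign_def power2_eq_square)
      also have "\<dots> = 4 * a\<^sup>2 * dist_frac n x y" by (simp only: avg_cmult dist_frac_def)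
      also have "\<dots> \<le> avg (seqs {1..n} k) (\<lambda>is. avg (cube k)
        (\<lambda>\<sigma>. (of_bool (g (shifted x is \<sigma>)) - of_bool (g (shifted y is \<sigma>)))\<^sup>2))"
        by (rule sens[OF xy])
      also have "\<dots> \<le> avg (tuples k n) (\<lambda>is. avg (cube k)
        (\<lambda>\<sigma>. (of_bool (g (shifted x is \<sigma>)) - of_bool (g (shifted y is \<sigma>)))\<^sup>2)) + repeat_frac k n"
      proof -
        have "0 \<le> avg (cube k) (\<lambda>\<sigma>. (of_bool (g (shifted x is \<sigma>)) - of_bool (g (shifted y is \<sigma>)))\<^sup>2)" for "is"
          by (intro avg_nonneg) auto
        moreover have "avg (cube k) (\<lambda>\<sigma>. (of_bool (g (shifted x is \<sigma>)) - of_bool (g (shifted y is \<sigma>)))\<^sup>2) \<le> 1" for "is"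
          by (intro avg_le_const) auto
        ultimately show ?thesis using avg_tuples_ge[OF k, of "\<lambda>is. avg (cube k)
        (\<lambda>\<sigma>. (of_bool (g (shifted x is \<sigma>)) - of_bool (g (shifted y is \<sigma>)))\<^sup>2)"] by fastforce
      qed
      also have "\<dots> = avg (clauses k n) (\<lambda>C. (?f C x - ?f C y)\<^sup>2) + repeat_frac k n"
        by (simp add: clauses_eq avg_Times satisfies_eq)
      finally show ?thesis .
    qed
  qed (use B finB k b in \<open>auto simp: clauses_nonempty literals_nonempty\<close>)
  moreover have "ln (card B) / b \<le> n * ln 2 / b"
  proof -
    have "ln (card B) \<le> ln (2 ^ n :: real)"
    proof (rule ln_mono)
      show "0 < real (card B)" using B finB by (simp add: card_gt_0_iff)
      have "card B \<le> 2 ^ n" using card_mono[OF finite_assignments B(1)] by (simp add: card_assignments)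
      then show "real (card B) \<le> 2 ^ n" by (metis of_nat_le_iff of_nat_numeral of_nat_power)
    qed
    then show ?thesis using b by (simp add: ln_realpow divide_right_mono)
  qed
  ultimately show ?thesis by (simp add: expected_max_eq[OF k(1)] avg_cmult)
qed

section \<open>Squared increments of clauses in terms of the distance\<close>

definition sensitivity :: "nat \<Rightarrow> (bool list \<Rightarrow> bool) \<Rightarrow> nat \<Rightarrow> (nat \<Rightarrow> bool) \<Rightarrow> (nat \<Rightarrow> bool) \<Rightarrow> real" where
  "sensitivity k g n x y = avg (seqs {1..n} k) (\<lambda>is. avg (cube k)
     (\<lambda>\<sigma>. (of_bool (g (shifted x is \<sigma>)) - of_bool (g (shifted y is \<sigma>)))\<^sup>2))"

lemma dist_frac_nonneg: "0 \<le> dist_frac n x y"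
  unfolding dist_frac_def by (rule avg_nonneg) simp

text \<open>For values 0 and 1, \<open>(u - v)^2 = u + v - 2 u v\<close>, so the sensitivity is
  twice the gap between \<open>p\<close> and the noise form. In \<open>noise_form_le\<close> the
  values at noise 0 and \<open>1 / 2\<close> are \<open>p\<close> and \<open>p^2\<close>.\<close>

lemma sensitivity_ge:
  assumes n: "n \<ge> 1" and d: "dist_frac n x y \<le> 2 / 3"
    and p: "p = avg (cube k) (\<lambda>z. of_bool (g z))"
  shows "4 * (2 / 3 * (p * (1 - p))) * dist_frac n x y \<le> sensitivity k g n x y"
proof -
  define G where "G z = (of_bool (g z) :: real)" for z
  define d where "d = dist_frac n x y"
  have Gsq: "G z * G z = G z" for z by (simp add: G_def)
  have sq: "(u - v)\<^sup>2 = u + v - 2 * (u * v)" if "u = G z" "v = G z'" for u v z z'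
    using that by (simp add: G_def power2_eq_square)
  have mean: "avg (cube k) (\<lambda>\<sigma>. G (shifted x is \<sigma>)) = p" if "is \<in> seqs {1..n} k" for x "is"
  proof -
    have "length is = k" using that by (simp add: seqs_def)
    from avg_bij[OF bij_shifted[OF this, of x], of G] show ?thesis
      by (simp add: p G_def[abs_def])
  qed
  have ne: "finite (seqs {1..n} k)" "seqs {1..n} k \<noteq> {}" using n by auto
  have "sensitivity k g n x y = avg (seqs {1..n} k) (\<lambda>is. avg (cube k)
      (\<lambda>\<sigma>. G (shifted x is \<sigma>) + G (shifted y is \<sigma>) - 2 * (G (shifted x is \<sigma>) * G (shifted y is \<sigma>))))"
    unfolding sensitivity_def by (simp add: G_def[symmetric] sq)
  also have "\<dots> = avg (seqs {1..n} k) (\<lambda>is. (p + p) - 2 * avg (cube k) (\<lambda>\<sigma>. G (shifted x is \<sigma>) * G (shifted y is \<sigma>)))"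
    by (rule avg_cong) (simp add: avg_diff avg_add avg_cmult mean)
  also have "\<dots> = 2 * (p - noise_form d k G G)"
    unfolding avg_diff avg_cmult avg_noise_form[OF n] avg_const[OF ne] d_def by simp
  finally have 1: "sensitivity k g n x y = 2 * (p - noise_form d k G G)" .
  have "noise_form d k G G \<le> (1 - 4 / 3 * d) * noise_form 0 k G G + 4 / 3 * d * noise_form (1 / 2) k G G"
    using assms dist_frac_nonneg by (intro noise_form_le) (auto simp: d_def)
  also have "noise_form 0 k G G = p"
    unfolding noise_form_0_eq Gsq by (simp add: p G_def)
  also have "noise_form (1 / 2) k G G = p\<^sup>2"
    unfolding noise_form_half_eq by (simp add: p G_def[abs_def])
  finally have "noise_form d k G G \<le> (1 - 4 / 3 * d) * p + 4 / 3 * d * p\<^sup>2" .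
  then have "2 * (p - ((1 - 4 / 3 * d) * p + 4 / 3 * d * p\<^sup>2)) \<le> 2 * (p - noise_form d k G G)"
    by (intro mult_left_mono diff_left_mono) auto
  moreover have "4 * (2 / 3 * (p * (1 - p))) * d = 2 * (p - ((1 - 4 / 3 * d) * p + 4 / 3 * d * p\<^sup>2))"
    by (simp add: power2_eq_square) (simp add: algebra_simps)
  ultimately show ?thesis unfolding 1 d_def[symmetric] by (simp only:)
qed

text \<open>If the first index separates \<open>x\<close> and \<open>y\<close>, no sign vector lets
  them see the same point. The two sign vectors that take \<open>x\<close>, respectively
  \<open>y\<close>, to \<open>z0\<close> are therefore distinct, and at each of them exactly one of
  the two assignments sees \<open>z0\<close>. Looking at the first index alone gives a bound linear
  in the distance, without restriction on it.\<close>

lemma sensitivity_ge_singleton: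
  assumes n: "n \<ge> 1" and k: "k \<ge> 1" and z0: "z0 \<in> cube k" "\<And>z. z \<in> cube k \<Longrightarrow> (g z = b) = (z = z0)"
  shows "2 / 2 ^ k * dist_frac n x y \<le> sensitivity k g n x y"
proof -
  let ?D = "\<lambda>is \<sigma>. (of_bool (g (shifted x is \<sigma>)) - of_bool (g (shifted y is \<sigma>)))\<^sup>2 :: real"
  obtain k' where k': "k = Suc k'" using k by (cases k) auto
  have ne: "finite (seqs {1..n} k')" "seqs {1..n} k' \<noteq> {}" using n by auto
  have "2 / 2 ^ k * dist_frac n x y = avg (seqs {1..n} k) (\<lambda>is. 2 / 2 ^ k * of_bool (x (hd is) \<noteq> y (hd is)))"
    unfolding k' avg_seqs_Suc dist_frac_def by (simp only: avg_cmult list.sel avg_const[OF ne])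
  also have "\<dots> \<le> sensitivity k g n x y"
    unfolding sensitivity_def
  proof (rule avg_mono)
    fix "is" assume "is": "is \<in> seqs {1..n} k"
    then have len: "length is = k" by (simp add: seqs_def)
    show "2 / 2 ^ k * of_bool (x (hd is) \<noteq> y (hd is)) \<le> avg (cube k) (?D is)"
    proof (cases "x (hd is) \<noteq> y (hd is)")
      case True
      obtain i is' where is_eq: "is = i # is'" using len k' by (cases "is") auto
      have neq: "shifted x is \<sigma> \<noteq> shifted y is \<sigma>" if \<sigma>: "\<sigma> \<in> cube k" for \<sigma>
      proof -
        obtain s \<sigma>' where "\<sigma> = s # \<sigma>'" using \<sigma> k' by (cases \<sigma>) (simp_all add: cube_def)
        then show ?thesis using True by (auto simp: is_eq)
      qed
      have inv: "shifted u is (shifted u is z0) = z0" "shifted u is z0 \<in> cube k"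
          "\<And>\<sigma>. \<sigma> \<in> cube k \<Longrightarrow> shifted u is \<sigma> \<in> cube k" for u
        using z0(1) len shifted_shifted bij_betwE[OF bij_shifted[OF len, of u]] by (auto simp: cube_def)
      have one: "?D is \<sigma> = 1" if \<sigma>: "\<sigma> = shifted x is z0 \<or> \<sigma> = shifted y is z0" for \<sigma>
      proof -
        have "\<sigma> \<in> cube k" using \<sigma> inv by auto
        then have "(shifted x is \<sigma> = z0) \<noteq> (shifted y is \<sigma> = z0)"
          using \<sigma> inv neq by metis
        then have "g (shifted x is \<sigma>) \<noteq> g (shifted y is \<sigma>)"
          using z0(2) inv(3)[OF \<open>\<sigma> \<in> cube k\<close>] by blast
        then show ?thesis by auto
      qed
      have "2 = (\<Sum>\<sigma>\<in>{shifted x is z0, shifted y is z0}. ?D is \<sigma>)"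
        using neq[OF z0(1)] one by simp
      also have "\<dots> \<le> (\<Sum>\<sigma>\<in>cube k. ?D is \<sigma>)"
        using inv by (intro sum_mono2) auto
      finally have "2 / 2 ^ k \<le> (\<Sum>\<sigma>\<in>cube k. ?D is \<sigma>) / 2 ^ k"
        by (rule divide_right_mono) simp
      then show ?thesis using True by (simp add: avg_def card_cube)
    next
      case False
      then show ?thesis by (simp add: avg_nonneg)
    qed
  qed
  finally show ?thesis .
qed

lemma sum_abs_imbalance_attained:
  "\<exists>x\<in>assignments n. (\<Sum>j=1..n. \<bar>real_of_int (imbalance {j} F)\<bar>)
     \<le> (\<Sum>j=1..n. bsign (x j) * real_of_int (imbalance {j} F))"
proof (intro bexI)
  let ?x = "\<lambda>j\<in>{1..n}. 0 \<le> imbalance {j} F"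
  show "?x \<in> assignments n" by (simp add: assignments_def)
  show "(\<Sum>j=1..n. \<bar>real_of_int (imbalance {j} F)\<bar>) \<le> (\<Sum>j=1..n. bsign (?x j) * real_of_int (imbalance {j} F))"
    by (intro sum_mono) (auto simp: bsign_def)
qed

text \<open>Restricting every triple to an odd number of true variables keeps all distances between
  assignments at most \<open>2/3\<close>, as needed for \<open>noise_form_le\<close>.\<close>

definition triple_assignments :: "nat \<Rightarrow> (nat \<Rightarrow> bool) set" where
  "triple_assignments n = {x \<in> assignments n.
     (\<forall>l<n div 3. x (3 * l + 1) = (x (3 * l + 2) = x (3 * l + 3))) \<and>
     (\<forall>j\<in>{3 * (n div 3) + 1..n}. x j)}"

text \<open>Two patterns of equal parity on a triple differ in 0 or 2 places, and the leftover
  variables are fixed.\<close>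

lemma dist_frac_triple_assignments:
  assumes n: "n \<ge> 1" and x: "x \<in> triple_assignments n" and y: "y \<in> triple_assignments n"
  shows "dist_frac n x y \<le> 2 / 3"
proof -
  let ?d = "\<lambda>j. of_bool (x j \<noteq> y j) :: real"
  have "(\<Sum>j=1..n. ?d j) = (\<Sum>l<n div 3. ?d (3 * l + 1) + ?d (3 * l + 2) + ?d (3 * l + 3))
     + (\<Sum>j=3 * (n div 3) + 1..n. ?d j)"
    by (rule sum_triples)
  also have "(\<Sum>j=3 * (n div 3) + 1..n. ?d j) = 0"
    using x y by (intro sum.neutral) (auto simp: triple_assignments_def)
  also have "(\<Sum>l<n div 3. ?d (3 * l + 1) + ?d (3 * l + 2) + ?d (3 * l + 3)) \<le> (\<Sum>l<n div 3. 2)"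
  proof (rule sum_mono)
    fix l assume "l \<in> {..<n div 3}"
    then have "x (3 * l + 1) = (x (3 * l + 2) = x (3 * l + 3))" "y (3 * l + 1) = (y (3 * l + 2) = y (3 * l + 3))"
      using x y by (auto simp: triple_assignments_def)
    then show "?d (3 * l + 1) + ?d (3 * l + 2) + ?d (3 * l + 3) \<le> 2"
      by (cases "x (3 * l + 2) = y (3 * l + 2)"; cases "x (3 * l + 3) = y (3 * l + 3)") auto
  qed
  also have "(\<Sum>l<n div 3. 2) + 0 \<le> 2 / 3 * real n"
    by (simp add: field_simps)
  finally show ?thesis using n by (simp add: dist_frac_def avg_def field_simps)
qed

definition triple_value :: "nat \<Rightarrow> literal list \<Rightarrow> real" where
  "triple_value n F = (\<Sum>l<n div 3. triple_max (imbalance {3 * l + 1} F) (imbalance {3 * l + 2} F) (imbalance {3 * l + 3} F))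
     + (\<Sum>j=3 * (n div 3) + 1..n. real_of_int (imbalance {j} F))"

lemma triple_value_attained:
  "\<exists>x\<in>triple_assignments n. triple_value n F \<le> (\<Sum>j=1..n. bsign (x j) * real_of_int (imbalance {j} F))"
proof -
  let ?I = "\<lambda>j. real_of_int (imbalance {j} F)"
  have "\<exists>q. fst q = (fst (snd q) = snd (snd q)) \<and> triple_max (?I (3 * l + 1)) (?I (3 * l + 2)) (?I (3 * l + 3))
      = bsign (fst q) * ?I (3 * l + 1) + bsign (fst (snd q)) * ?I (3 * l + 2) + bsign (snd (snd q)) * ?I (3 * l + 3)" for l
    by (rule triple_max_attained[of "?I (3 * l + 1)" "?I (3 * l + 2)" "?I (3 * l + 3)"]) force
  then obtain q where q: "\<forall>l. fst (q l) = (fst (snd (q l)) = snd (snd (q l))) \<and>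
      triple_max (?I (3 * l + 1)) (?I (3 * l + 2)) (?I (3 * l + 3))
      = bsign (fst (q l)) * ?I (3 * l + 1) + bsign (fst (snd (q l))) * ?I (3 * l + 2) + bsign (snd (snd (q l))) * ?I (3 * l + 3)"
    using choice[of "\<lambda>l q. fst q = (fst (snd q) = snd (snd q)) \<and> triple_max (?I (3 * l + 1)) (?I (3 * l + 2)) (?I (3 * l + 3))
      = bsign (fst q) * ?I (3 * l + 1) + bsign (fst (snd q)) * ?I (3 * l + 2) + bsign (snd (snd q)) * ?I (3 * l + 3)"]
    by blast
  define s t u where "s l = fst (q l)" and "t l = fst (snd (q l))" and "u l = snd (snd (q l))" for l
  have stu: "s l = (t l = u l)"
    "triple_max (?I (3 * l + 1)) (?I (3 * l + 2)) (?I (3 * l + 3))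
      = bsign (s l) * ?I (3 * l + 1) + bsign (t l) * ?I (3 * l + 2) + bsign (u l) * ?I (3 * l + 3)" for l
    using q unfolding s_def t_def u_def by blast+
  \<comment> \<open>The third variable of block \<open>l\<close> is \<open>3 * l + 3\<close>, whose
    quotient by 3 is already \<open>l + 1\<close>; hence the \<open>- 1\<close>.\<close>
  define y where "y j = (if j > 3 * (n div 3) then True else
      if j mod 3 = 1 then s (j div 3) else if j mod 3 = 2 then t (j div 3) else u (j div 3 - 1))" for j
  define x where "x = restrict y {1..n}"
  have G: "3 * (n div 3) \<le> n" by simp
  have x1: "x (3 * l + 1) = s l" "x (3 * l + 2) = t l" "x (3 * l + 3) = u l" if "l < n div 3" for l
  proof -
    have "(3 * l + 1) mod 3 = 1" "(3 * l + 2) mod 3 = 2" "(3 * l + 3) mod 3 = 0"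
      "(3 * l + 1) div 3 = l" "(3 * l + 2) div 3 = l" "(3 * l + 3) div 3 = Suc l"
      by presburger+
    moreover have "3 * l + 3 \<le> 3 * (n div 3)" using that by simp
    ultimately show "x (3 * l + 1) = s l" "x (3 * l + 2) = t l" "x (3 * l + 3) = u l"
      using G by (auto simp: x_def y_def)
  qed
  have x2: "x j" if "j \<in> {3 * (n div 3) + 1..n}" for j
    using that by (auto simp: x_def y_def)
  have "x \<in> triple_assignments n"
    using x1 x2 stu(1) by (auto simp: triple_assignments_def assignments_def x_def)
  moreover have "triple_value n F = (\<Sum>j=1..n. bsign (x j) * ?I j)"
    unfolding triple_value_def sum_triples[of _ n] using x1 x2 stu(2)
    by (intro arg_cong2[where f = "(+)"] sum.cong refl) simp_all
  ultimately show ?thesis by (intro bexI[of _ x]) simp_all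
qed

lemma abs_imbalance_asymp:
  fixes c :: real
  assumes n: "n \<ge> 1" and c: "c \<ge> 2" and J: "J \<subseteq> {1..n}" "J \<noteq> {}"
  shows "walk_const * sqrt (card J) * (sqrt c - 1) - 5
    \<le> avg (seqs (literals n) (nat \<lfloor>c * real n\<rfloor>)) (\<lambda>F. \<bar>real_of_int (imbalance J F)\<bar>)"
proof -
  define m where "m = nat \<lfloor>c * real n\<rfloor>"
  have "1 \<le> card J" using J finite_subset[OF J(1)] by (simp add: Suc_le_eq card_gt_0_iff)
  then have cJ: "1 \<le> real (card J)" by simp
  have "c * real n - 1 \<le> real m" unfolding m_def using c by linarith
  then have m: "c - 1 \<le> m / n" using n by (simp add: field_simps)
  have "c - 1 \<le> (m / n) * card J"
    using mult_mono[of "c - 1" "m / n" 1 "card J"] m cJ c by simp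
  then have "1 \<le> m * (card J / n)" using c by simp
  from avg_abs_imbalance_ge[OF n J(1) this]
  have 1: "walk_const * sqrt (m * (card J / n)) - 5
    \<le> avg (seqs (literals n) m) (\<lambda>F. \<bar>real_of_int (imbalance J F)\<bar>)" .
  have "sqrt c \<le> sqrt (c - 1) + sqrt 1"
    using sqrt_add_le_add_sqrt[of "c - 1" 1] c by simp
  then have "sqrt c - 1 \<le> sqrt (c - 1)" by simp
  also have "\<dots> \<le> sqrt (m / n)" using m by simp
  finally have "walk_const * sqrt (card J) * (sqrt c - 1) \<le> walk_const * sqrt (card J) * sqrt (m / n)"
    using walk_const by (intro mult_left_mono) auto
  also have "\<dots> = walk_const * sqrt (m * (card J / n))"
    by (simp add: real_sqrt_mult real_sqrt_divide)
  finally show ?thesis using 1 by (simp add: m_def)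
qed

lemma avg_sum_abs_imbalance_ge:
  fixes c :: real
  assumes n: "n \<ge> 1" and c: "c \<ge> 2"
  shows "n * (walk_const * sqrt c - 6)
    \<le> avg (seqs (literals n) (nat \<lfloor>c * real n\<rfloor>)) (\<lambda>F. \<Sum>j=1..n. \<bar>real_of_int (imbalance {j} F)\<bar>)"
proof -
  have "(\<Sum>j=1..n. walk_const * sqrt c - 6)
    \<le> (\<Sum>j=1..n. avg (seqs (literals n) (nat \<lfloor>c * real n\<rfloor>)) (\<lambda>F. \<bar>real_of_int (imbalance {j} F)\<bar>))"
  proof (rule sum_mono)
    fix j assume "j \<in> {1..n}"
    then have "walk_const * sqrt (card {j}) * (sqrt c - 1) - 5
      \<le> avg (seqs (literals n) (nat \<lfloor>c * real n\<rfloor>)) (\<lambda>F. \<bar>real_of_int (imbalance {j} F)\<bar>)"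
      by (intro abs_imbalance_asymp n c) auto
    moreover note walk_const(2)
    ultimately show "walk_const * sqrt c - 6
      \<le> avg (seqs (literals n) (nat \<lfloor>c * real n\<rfloor>)) (\<lambda>F. \<bar>real_of_int (imbalance {j} F)\<bar>)"
      by (simp only: right_diff_distrib) simp
  qed
  then show ?thesis by (simp add: avg_sum)
qed

lemma avg_triple_value_ge:
  fixes c :: real
  assumes n: "n \<ge> 1" and c: "c \<ge> 2"
  shows "real (n div 3) * (walk_const * (1 + sqrt 2) * sqrt c - 13)
    \<le> avg (seqs (literals n) (nat \<lfloor>c * real n\<rfloor>)) (triple_value n)"
proof -
  let ?avg = "avg (seqs (literals n) (nat \<lfloor>c * real n\<rfloor>))"
  \<comment> \<open>Here 13 is 5 for each of the two walks plus 3, an upper bound for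
    \<open>walk_const * (1 + sqrt 2)\<close>.\<close>
  have "(\<Sum>l<n div 3. walk_const * (1 + sqrt 2) * sqrt c - 13)
    \<le> (\<Sum>l<n div 3. ?avg (\<lambda>F. triple_max (imbalance {3 * l + 1} F) (imbalance {3 * l + 2} F) (imbalance {3 * l + 3} F)))"
  proof (rule sum_mono)
    fix l assume "l \<in> {..<n div 3}"
    then have l: "3 * l + 3 \<le> n" by auto
    have "walk_const * sqrt (card {3 * l + 3}) * (sqrt c - 1) - 5
      \<le> ?avg (\<lambda>F. \<bar>real_of_int (imbalance {3 * l + 3} F)\<bar>)"
      using l by (intro abs_imbalance_asymp n c) auto
    moreover have "walk_const * sqrt (card {3 * l + 1, 3 * l + 2}) * (sqrt c - 1) - 5
      \<le> ?avg (\<lambda>F. \<bar>real_of_int (imbalance {3 * l + 1, 3 * l + 2} F)\<bar>)"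
      using l by (intro abs_imbalance_asymp n c) auto
    moreover note walk_const(2)
    moreover have "walk_const * sqrt 2 \<le> 1 * 2"
      using walk_const by (intro mult_mono real_le_lsqrt) auto
    moreover note avg_triple_max[of "3 * l + 1" "3 * l + 2" "3 * l + 3" n "nat \<lfloor>c * real n\<rfloor>"]
    ultimately show "walk_const * (1 + sqrt 2) * sqrt c - 13
      \<le> ?avg (\<lambda>F. triple_max (imbalance {3 * l + 1} F) (imbalance {3 * l + 2} F) (imbalance {3 * l + 3} F))"
      by (simp add: algebra_simps del: real_sqrt_divide)
  qed
  then show ?thesis
    by (simp add: triple_value_def[abs_def] avg_add avg_sum avg_imbalance_zero)
qed

subsection \<open>Asymptotics\<close>

text \<open>Strict slack in the coefficient of \<open>sqrt c\<close> reduces the relation to an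
  eventual inequality; no limit of quotients is computed unless \<open>g\<close> is constantly
  true.\<close>

lemma asymp_leI:
  assumes "\<forall>\<^sub>F n in sequentially. 0 \<le> a n \<and> a n \<le> b n"
  shows "asymp_le a b"
  unfolding asymp_le_def
proof (rule Limsup_bounded, use assms in eventually_elim)
  case (elim n)
  show "ereal (a n) / ereal (b n) \<le> 1"
  proof (cases "b n = 0")
    case True
    then have "a n = 0" using elim by simp
    then show ?thesis using True by simp
  next
    case False
    then show ?thesis using elim by (simp add: one_ereal_def)
  qed
qed

lemma expected_max_nonneg: "0 \<le> expected_max k g n m"
  unfolding expected_max_def by (intro Bochner_Integration.integral_nonneg) simp

lemma expected_max_constant:
  assumes k: "k \<le> n" and g: "\<And>z. z \<in> cube k \<Longrightarrow> g z = b"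
  shows "expected_max k g n m = of_bool b * m"
proof -
  have sat: "satisfies g x C = b" if "C \<in> clauses k n" for x C
  proof -
    obtain "is" \<sigma> where C: "C = (is, \<sigma>)" "length is = k" "\<sigma> \<in> cube k"
      using \<open>C \<in> clauses k n\<close> by (auto simp: clauses_def)
    then show ?thesis using bij_betwE[OF bij_shifted[OF C(2), of x]] g by (simp add: satisfies_eq)
  qed
  have "real (max_sat g n F) = of_bool b * m" if F: "F \<in> seqs (clauses k n) m" for F
  proof -
    obtain x where x: "max_sat g n F = num_sat g x F" by (rule max_sat_attained)
    have "filter (satisfies g x) F = (if b then F else [])"
      using F sat by (auto simp: seqs_def filter_empty_conv filter_id_conv subset_iff)
    then show ?thesis using F unfolding x num_sat_def by (simp add: seqs_def)
  qed
  then have "expected_max k g n m = avg (seqs (clauses k n) m) (\<lambda>_. of_bool b * m)"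
    unfolding expected_max_eq[OF k] by (rule avg_cong)
  then show ?thesis using clauses_nonempty[OF k] by (simp add: avg_const)
qed

lemma expected_max_upper_asymp:
  assumes k: "k \<ge> 1" and p: "p = avg (cube k) (\<lambda>z. of_bool (g z))" and p01: "0 < p" "p < 1"
  shows "\<forall>\<^sub>F c :: real in at_top. \<forall>\<^sub>F n in sequentially.
    expected_max k g n (nat \<lfloor>c * real n\<rfloor>) \<le> (p * c + sqrt (2 * (p * (1 - p)) * ln 2 * c)) * n"
proof -
  define V where "V = p * (1 - p)"
  define s where "s = sqrt (2 * V * ln 2)"
  \<comment> \<open>The minimiser of \<open>ln 2 / l + l * V / 2\<close>; the minimum
    \<open>s\<close> is the claimed coefficient of \<open>sqrt c\<close>.\<close>
  define l where "l = s / V"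
  have V: "0 < V" using p01 by (simp add: V_def)
  have s: "0 < s" "s\<^sup>2 = 2 * V * ln 2" using V by (auto simp: s_def)
  have l: "0 < l" "l * V = s" using s V by (auto simp: l_def)
  have ln2: "ln 2 / l + l * V / 2 = s"
  proof -
    have "ln 2 / l = s\<^sup>2 / (2 * V) / (s / V)" using s V by (simp add: l_def)
    also have "\<dots> = s / 2" using s(1) V by (simp add: power2_eq_square)
    finally have "ln 2 / l = s / 2" .
    then show ?thesis unfolding l(2) by linarith
  qed
  \<comment> \<open>Large enough that the entropy gain \<open>ln r / l\<close> exceeds by 1 the loss
    coefficient \<open>2 k (ln 2 + 1/4)\<close>, which is at most \<open>2 k\<close>.\<close>
  define r where "r = nat \<lceil>exp (l * (2 * real k + 1))\<rceil>"
  have r_ge: "exp (l * (2 * real k + 1)) \<le> real r" unfolding r_def by linarith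
  then have r: "r \<ge> 1" "0 < real r" using exp_gt_zero[of "l * (2 * real k + 1)"] by linarith+
  have lnr: "l * (2 * real k + 1) \<le> ln r" using r_ge r by (simp add: ln_ge_iff)
  define \<eta> where "\<eta> = 1 / real r"
  have \<eta>: "0 < \<eta>" using r by (simp add: \<eta>_def)
  \<comment> \<open>The thresholds for \<open>c\<close> ensure \<open>lam \<le> 1 / 4\<close> and
    let the net gain \<open>q * \<eta>\<close> pay for \<open>4 * l\<^sup>2\<close>, from the cubic
    remainder, and 1, from the rounding in \<open>n div r\<close>.\<close>
  show ?thesis
    using eventually_ge_at_top[of "max 1 (max ((4 * l)\<^sup>2) (((4 * l\<^sup>2 + 1) / \<eta>)\<^sup>2))"]
  proof eventually_elim
    case (elim c)
    define q where "q = sqrt c"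
    have c: "1 \<le> c" "(4 * l)\<^sup>2 \<le> c" "((4 * l\<^sup>2 + 1) / \<eta>)\<^sup>2 \<le> c" using elim by auto
    have q: "1 \<le> q" "q\<^sup>2 = c" "4 * l \<le> q" "(4 * l\<^sup>2 + 1) / \<eta> \<le> q"
      using c by (auto simp: q_def intro: real_le_rsqrt)
    define lam where "lam = l / q"
    have lam: "0 < lam" "lam \<le> 1 / 4" using l q by (auto simp: lam_def field_simps)
    \<comment> \<open>Makes the two parts of the loss bound comparable, \<open>ln 2\<close> against
      \<open>1 / 4\<close> per variable.\<close>
    define t where "t = real r / (2 * real k * q)"
    have t: "0 < t" using r k q by (simp add: t_def)
    have ta: "t * (real k / real r) = 1 / (2 * q)" using r k q by (simp add: t_def field_simps)
    have ta2: "t * (real k / real r) \<le> 1 / 2" unfolding ta using q by (simp add: field_simps)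
    show ?case
      using eventually_ge_at_top[of "max k (nat \<lceil>ln r * q / l\<rceil>)"]
    proof eventually_elim
      case (elim n)
      have n: "k \<le> n" "1 \<le> n" "ln r * q / l \<le> n" using elim k by (auto simp: nat_le_iff ceiling_le_iff)
      define m where "m = nat \<lfloor>c * real n\<rfloor>"
      have m: "real m \<le> c * n" unfolding m_def using c by simp
      define E where "E = expected_max k g n m"
      have "lam * E \<le> n * ln 2 + m * (lam * p + lam\<^sup>2 / 2 * V + 4 * lam ^ 3)
        - real (n div r) * ln r + lam / t * (n * ln 2 + m * (1 / (2 * q))\<^sup>2)"
        using expected_max_upper[OF n(1) r(1) p lam t ta2, of m] unfolding ta E_def V_def .
      also have "\<dots> \<le> n * ln 2 + (c * n) * (lam * p + lam\<^sup>2 / 2 * V + 4 * lam ^ 3)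
        - (n / r - 1) * ln r + lam / t * (n * ln 2 + (c * n) * (1 / (2 * q))\<^sup>2)"
      proof -
        have "n / r - 1 \<le> real (n div r)"
        proof -
          have "n < (n div r + 1) * r" using dividend_less_div_times[of r n] r by simp
          then have "real n < real ((n div r + 1) * r)" by (simp only: of_nat_less_iff)
          then show ?thesis using r by (simp add: field_simps)
        qed
        moreover have "0 \<le> ln r" using r by simp
        moreover have "0 \<le> lam * p + lam\<^sup>2 / 2 * V + 4 * lam ^ 3" using lam p01 V by simp
        ultimately show ?thesis
          using m lam t by (intro add_mono diff_mono mult_right_mono mult_left_mono order_refl) auto
      qed
      also have "\<dots> = lam * (n * (p * c + q * (ln 2 / l + l * V / 2) + 4 * l\<^sup>2
          - q * (ln r / l - 2 * real k * (ln 2 + 1 / 4)) / r) + ln r * q / l)"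
        using l q(1) r k unfolding q(2)[symmetric] lam_def t_def
        by (simp add: field_simps power2_eq_square power3_eq_cube)
      finally have "E \<le> n * (p * c + q * (ln 2 / l + l * V / 2) + 4 * l\<^sup>2
          - q * (ln r / l - 2 * real k * (ln 2 + 1 / 4)) / r) + ln r * q / l"
        using lam by simp
      also have "\<dots> \<le> n * (p * c + q * s + 4 * l\<^sup>2 - q * \<eta>) + real n * 1"
      proof -
        have "ln (2 :: real) \<le> 3 / 4" using ln2_le_25_over_36 by simp
        then have "2 * real k * (ln 2 + 1 / 4) \<le> 2 * real k * 1" by (intro mult_left_mono) auto
        moreover have "2 * real k + 1 \<le> ln r / l" using lnr l by (simp add: field_simps)
        ultimately have "1 \<le> ln r / l - 2 * real k * (ln 2 + 1 / 4)" by linarith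
        then have "q * 1 / r \<le> q * (ln r / l - 2 * real k * (ln 2 + 1 / 4)) / r"
          using q r by (intro divide_right_mono mult_left_mono) auto
        then show ?thesis using n(3) unfolding ln2 \<eta>_def
          by (intro add_mono mult_left_mono) auto
      qed
      also have "\<dots> \<le> n * (p * c + q * s)"
      proof -
        have "4 * l\<^sup>2 + 1 \<le> q * \<eta>" using q(4) \<eta> by (simp add: field_simps)
        then show ?thesis unfolding distrib_left[symmetric] by (intro mult_left_mono) auto
      qed
      finally show ?case
        by (simp add: E_def m_def q_def s_def V_def real_sqrt_mult mult_ac)
    qed
  qed
qed

text \<open>With \<open>b = a / sqrt c\<close> the entropy term costs half of the gap
  \<open>\<Gamma> - \<gamma>\<close> by the choice of \<open>a\<close>. For large \<open>c\<close>
  the other half absorbs \<open>D + 8 a^2 + 3\<close>, where 3 counts one unit each for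
  \<open>D' * sqrt c\<close>, the rounding of \<open>c n\<close> and the repeated indices.\<close>

lemma lower_asymp_of_bound:
  fixes \<Gamma> \<gamma> D D' p :: real
  assumes \<gamma>: "\<gamma> < \<Gamma>" and p: "0 \<le> p" "p \<le> 1"
    and bound: "\<And>c n b. 2 \<le> c \<Longrightarrow> max 1 k \<le> n \<Longrightarrow> 0 < b \<Longrightarrow> b \<le> 1 / 4 \<Longrightarrow>
      n * (\<Gamma> * sqrt c - D) - D' * sqrt c + real (nat \<lfloor>c * real n\<rfloor>) * p - n * ln 2 / b
        - real (nat \<lfloor>c * real n\<rfloor>) * (8 * b\<^sup>2 + b * repeat_frac k n / 4)
      \<le> expected_max k g n (nat \<lfloor>c * real n\<rfloor>)"
  shows "\<forall>\<^sub>F c :: real in at_top. \<forall>\<^sub>F n in sequentially.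
    (p * c + \<gamma> * sqrt c) * n \<le> expected_max k g n (nat \<lfloor>c * real n\<rfloor>)"
proof -
  define a where "a = 2 * ln 2 / (\<Gamma> - \<gamma>)"
  have a: "0 < a" "ln 2 / a = (\<Gamma> - \<gamma>) / 2" using \<gamma> by (auto simp: a_def)
  define T where "T = 2 * (D + 8 * a\<^sup>2 + 3) / (\<Gamma> - \<gamma>)"
  show ?thesis
    using eventually_ge_at_top[of "max 2 (max ((4 * a)\<^sup>2) (T\<^sup>2))"]
  proof eventually_elim
    case (elim c)
    define q where "q = sqrt c"
    have c: "2 \<le> c" "(4 * a)\<^sup>2 \<le> c" "T\<^sup>2 \<le> c" using elim by auto
    have q: "0 < q" "q\<^sup>2 = c" "4 * a \<le> q" "T \<le> q"
      using c by (auto simp: q_def intro: real_le_rsqrt)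
    define b where "b = a / q"
    have b: "0 < b" "b \<le> 1 / 4" using a q by (auto simp: b_def field_simps)
    have "(\<lambda>n. q * a * repeat_frac k n) \<longlonglongrightarrow> q * a * 0"
      by (intro tendsto_intros repeat_frac_tendsto)
    then have "\<forall>\<^sub>F n in sequentially. q * a * repeat_frac k n < 4"
      by (rule order_tendstoD) simp
    moreover have "\<forall>\<^sub>F n in sequentially. max (max 1 k) (nat \<lceil>D' * q\<rceil>) \<le> n"
      by (rule eventually_ge_at_top)
    ultimately show ?case
    proof eventually_elim
      case (elim n)
      have n: "max 1 k \<le> n" "D' * q \<le> n" using elim(2) by (auto simp: nat_le_iff ceiling_le_iff)
      define m where "m = nat \<lfloor>c * real n\<rfloor>"
      have m: "c * n - 1 \<le> m" "m \<le> c * n" unfolding m_def using c by (linarith, simp)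
      define \<rho> where "\<rho> = repeat_frac k n"
      have \<rho>: "0 \<le> \<rho>"
      proof -
        have "card (tuples k n) \<le> n ^ k"
          using card_mono[OF finite_seqs tuples_subset[of k n]] by (simp add: card_seqs)
        then have "real (card (tuples k n)) \<le> real n ^ k" by (metis of_nat_le_iff of_nat_power)
        then show ?thesis using n by (simp add: \<rho>_def repeat_frac_def)
      qed
      have "n * ln 2 / b = n * (q * ((\<Gamma> - \<gamma>) / 2))" using a q by (simp add: b_def a(2)[symmetric])
      moreover have "m * (8 * b\<^sup>2 + b * \<rho> / 4) \<le> n * (8 * a\<^sup>2 + 1)"
      proof -
        have "m * (8 * b\<^sup>2 + b * \<rho> / 4) \<le> (c * n) * (8 * b\<^sup>2 + b * \<rho> / 4)"
          using m b \<rho> by (intro mult_right_mono) auto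
        also have "\<dots> = n * (8 * a\<^sup>2 + q * a * \<rho> / 4)"
          using q(1) unfolding q(2)[symmetric] b_def by (simp add: field_simps power2_eq_square)
        also have "\<dots> \<le> n * (8 * a\<^sup>2 + 1)"
          using elim(1) by (intro mult_left_mono) (auto simp: \<rho>_def)
        finally show ?thesis .
      qed
      moreover have "n * (c * p - 1) \<le> m * p"
      proof -
        have "(c * n - 1) * p \<le> m * p" using m p by (intro mult_right_mono)
        moreover have "p \<le> n" using p n by linarith
        ultimately show ?thesis by (simp add: algebra_simps)
      qed
      moreover have "n * (\<Gamma> * q - D) - D' * q + m * p - n * ln 2 / b - m * (8 * b\<^sup>2 + b * \<rho> / 4)
        \<le> expected_max k g n m"
        using bound[OF c(1) n(1) b] by (simp add: q_def m_def \<rho>_def)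
      ultimately have "n * (\<Gamma> * q - D) - n * 1 + n * (c * p - 1) - n * (q * ((\<Gamma> - \<gamma>) / 2)) - n * (8 * a\<^sup>2 + 1)
        \<le> expected_max k g n m"
        using n(2) by linarith
      moreover have "n * (c * p + \<gamma> * q) \<le> n * ((\<Gamma> * q - D) - 1 + (c * p - 1) - q * ((\<Gamma> - \<gamma>) / 2) - (8 * a\<^sup>2 + 1))"
      proof (rule mult_left_mono)
        have "D + 8 * a\<^sup>2 + 3 \<le> q * ((\<Gamma> - \<gamma>) / 2)"
          using q(4) \<gamma> by (simp add: T_def field_simps)
        moreover have "\<Gamma> * q - q * ((\<Gamma> - \<gamma>) / 2) = \<gamma> * q + q * ((\<Gamma> - \<gamma>) / 2)"
          by (simp add: field_simps)
        ultimately show "c * p + \<gamma> * q \<le> (\<Gamma> * q - D) - 1 + (c * p - 1) - q * ((\<Gamma> - \<gamma>) / 2) - (8 * a\<^sup>2 + 1)"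
          by linarith
      qed simp
      ultimately show ?case
        by (simp add: m_def q_def algebra_simps)
    qed
  qed
qed

lemma lower_asymp_singleton:
  assumes k: "k \<ge> 1" and p: "p = avg (cube k) (\<lambda>z. of_bool (g z))"
    and z0: "z0 \<in> cube k" "\<And>z. z \<in> cube k \<Longrightarrow> (g z = b) = (z = z0)"
    and \<gamma>: "0 \<le> \<gamma>" "\<gamma>\<^sup>2 < 61 / 200 * (1 / 2 ^ k)"
  shows "\<forall>\<^sub>F c :: real in at_top. \<forall>\<^sub>F n in sequentially.
    (p * c + \<gamma> * sqrt c) * n \<le> expected_max k g n (nat \<lfloor>c * real n\<rfloor>)"
proof -
  \<comment> \<open>Solves \<open>4 a^2 = 2 / 2^k\<close>, the sensitivity bound for a single
    point.\<close>
  define a where "a = sqrt (1 / 2 ^ k / 2)"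
  have a2: "a\<^sup>2 = 1 / 2 ^ k / 2" by (simp add: a_def)
  have "(1 :: real) \<le> 2 ^ k" by simp
  then have a2_le: "1 / 2 ^ k / 2 \<le> (1 :: real)" using order_trans[of 1 "2 ^ k" "2 ^ k * (2 :: real)"] by (simp add: divide_simps)
  have a: "0 \<le> a" "a \<le> 1" using a2_le by (simp_all add: a_def)
  have p01: "0 \<le> p" "p \<le> 1" unfolding p by (auto intro: avg_nonneg avg_le_const)
  show ?thesis
  proof (rule lower_asymp_of_bound[OF _ p01])
    show "\<gamma> < a * walk_const"
    proof (rule power2_less_imp_less)
      show "\<gamma>\<^sup>2 < (a * walk_const)\<^sup>2" using \<gamma>(2) by (simp add: power_mult_distrib a2 walk_const(3))
      show "0 \<le> a * walk_const" using a walk_const by simp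
    qed
    fix c b' :: real and n :: nat
    assume c: "2 \<le> c" and n: "max 1 k \<le> n" and b': "0 < b'" "b' \<le> 1 / 4"
    define m where "m = nat \<lfloor>c * real n\<rfloor>"
    let ?N = "\<lambda>F. \<Sum>j=1..n. \<bar>real_of_int (imbalance {j} F)\<bar>"
    have "a * avg (seqs (literals n) m) ?N + m * p - n * ln 2 / b' - m * (8 * b'\<^sup>2 + b' * repeat_frac k n / 4)
      \<le> expected_max k g n m"
    proof (rule expected_max_lower[where B = "assignments n"])
      show "4 * a\<^sup>2 * dist_frac n x y \<le> avg (seqs {1..n} k) (\<lambda>is. avg (cube k)
        (\<lambda>\<sigma>. (of_bool (g (shifted x is \<sigma>)) - of_bool (g (shifted y is \<sigma>)))\<^sup>2))" for x y
        using sensitivity_ge_singleton[OF _ k z0, of n x y] n by (simp add: a2 sensitivity_def)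
    qed (use n a b' p sum_abs_imbalance_attained in auto)
    moreover have "n * (a * walk_const * sqrt c - 6) \<le> a * avg (seqs (literals n) m) ?N"
    proof -
      have "a * (n * (walk_const * sqrt c - 6)) \<le> a * avg (seqs (literals n) m) ?N"
        unfolding m_def using n c by (intro mult_left_mono avg_sum_abs_imbalance_ge a) auto
      moreover have "real n * (a * 6) \<le> real n * (1 * 6)" using a by (intro mult_left_mono mult_right_mono) auto
      ultimately show ?thesis by (simp add: algebra_simps)
    qed
    ultimately show "n * (a * walk_const * sqrt c - 6) - 0 * sqrt c + real (nat \<lfloor>c * real n\<rfloor>) * p - n * ln 2 / b'
        - real (nat \<lfloor>c * real n\<rfloor>) * (8 * b'\<^sup>2 + b' * repeat_frac k n / 4)
      \<le> expected_max k g n (nat \<lfloor>c * real n\<rfloor>)"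
      unfolding m_def by linarith
  qed
qed

lemma triple_assignments_nonempty: "triple_assignments n \<noteq> {}"
proof -
  have "3 * l + 3 \<le> n" if "l < n div 3" for l using that by linarith
  then have "(\<lambda>j\<in>{1..n}. True) \<in> triple_assignments n"
    by (fastforce simp: triple_assignments_def assignments_def)
  then show ?thesis by blast
qed

lemma lower_asymp_general:
  assumes p: "p = avg (cube k) (\<lambda>z. of_bool (g z))"
    and \<gamma>: "0 \<le> \<gamma>" "\<gamma>\<^sup>2 \<le> p * (1 - p) / 4" and pq: "0 < p * (1 - p)"
  shows "\<forall>\<^sub>F c :: real in at_top. \<forall>\<^sub>F n in sequentially.
    (p * c + \<gamma> * sqrt c) * n \<le> expected_max k g n (nat \<lfloor>c * real n\<rfloor>)"
proof -
  define a where "a = sqrt (2 / 3 * (p * (1 - p)))"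
  have p01: "0 \<le> p" "p \<le> 1" unfolding p by (auto intro: avg_nonneg avg_le_const)
  have a2: "a\<^sup>2 = 2 / 3 * (p * (1 - p))" using pq by (simp add: a_def)
  have "p * (1 - p) \<le> 1 * 1" using p01 by (intro mult_mono) auto
  then have a: "0 \<le> a" "a \<le> 1" using pq by (simp_all add: a_def)
  define T where "T = walk_const * (1 + sqrt 2)"
  have sqrt2: "7 / 5 \<le> sqrt (2 :: real)" "sqrt (2 :: real) \<le> 2"
    using real_le_rsqrt[of "7 / 5" 2] real_le_lsqrt[of 2 2] by (simp_all add: power2_eq_square)
  have "T \<le> 1 * 3" unfolding T_def using walk_const sqrt2 by (intro mult_mono) auto
  then have T: "0 \<le> T" "T \<le> 3" using walk_const by (simp_all add: T_def)
  show ?thesis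
  proof (rule lower_asymp_of_bound[OF _ p01])
    show "\<gamma> < a * T / 3"
    proof (rule power2_less_imp_less)
      \<comment> \<open>\<open>29/5\<close> is just below \<open>(1 + sqrt 2)^2\<close>. The
        resulting factor \<open>2/3 * 61/100 * 29/5 / 9\<close> is about \<open>0.262\<close>, hence
        strictly above \<open>1 / 4\<close>.\<close>
      have "29 / 5 \<le> (1 + sqrt 2)\<^sup>2" using sqrt2 by (simp add: power2_eq_square algebra_simps)
      then have "61 / 100 * (29 / 5) \<le> T\<^sup>2"
        unfolding T_def power_mult_distrib walk_const(3) by (intro mult_left_mono) auto
      then have "(2 / 3 * (p * (1 - p))) * (61 / 100 * (29 / 5)) \<le> (2 / 3 * (p * (1 - p))) * T\<^sup>2"
        using pq by (intro mult_left_mono) auto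
      then have "(2 / 3 * (p * (1 - p))) * (61 / 100 * (29 / 5)) / 9 \<le> (a * T / 3)\<^sup>2"
        by (simp add: power_mult_distrib power_divide a2)
      then show "\<gamma>\<^sup>2 < (a * T / 3)\<^sup>2" using \<gamma>(2) pq by linarith
      show "0 \<le> a * T / 3" using a T by simp
    qed
    fix c b :: real and n :: nat
    assume c: "2 \<le> c" and n: "max 1 k \<le> n" and b: "0 < b" "b \<le> 1 / 4"
    define m where "m = nat \<lfloor>c * real n\<rfloor>"
    have "a * avg (seqs (literals n) m) (triple_value n) + m * p - n * ln 2 / b - m * (8 * b\<^sup>2 + b * repeat_frac k n / 4)
      \<le> expected_max k g n m"
    proof (rule expected_max_lower[where B = "triple_assignments n"])
      show "4 * a\<^sup>2 * dist_frac n x y \<le> avg (seqs {1..n} k) (\<lambda>is. avg (cube k)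
        (\<lambda>\<sigma>. (of_bool (g (shifted x is \<sigma>)) - of_bool (g (shifted y is \<sigma>)))\<^sup>2))"
        if "x \<in> triple_assignments n" "y \<in> triple_assignments n" for x y
        using sensitivity_ge[OF _ dist_frac_triple_assignments[OF _ that] p] n by (simp add: a2 sensitivity_def)
      show "triple_assignments n \<subseteq> assignments n" by (auto simp: triple_assignments_def)
    qed (use n a b p triple_value_attained triple_assignments_nonempty in auto)
    moreover have "n * (a * T / 3 * sqrt c - 5) - 3 * sqrt c \<le> a * avg (seqs (literals n) m) (triple_value n)"
    proof -
      have "a * (real (n div 3) * (T * sqrt c - 13)) \<le> a * avg (seqs (literals n) m) (triple_value n)"
        unfolding m_def T_def using n c by (intro mult_left_mono avg_triple_value_ge a) auto
      moreover have "(n / 3 - 1) * (a * T * sqrt c) \<le> real (n div 3) * (a * T * sqrt c)"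
        using a T c by (intro mult_right_mono) (linarith, simp)
      moreover have "real (n div 3) * (a * 13) \<le> n / 3 * (1 * 13)"
        using a by (intro mult_mono) auto
      moreover have "a * T * sqrt c \<le> 1 * 3 * sqrt c"
        using a T c by (intro mult_right_mono mult_mono) auto
      ultimately show ?thesis by (simp add: algebra_simps)
    qed
    ultimately show "n * (a * T / 3 * sqrt c - 5) - 3 * sqrt c + real (nat \<lfloor>c * real n\<rfloor>) * p - n * ln 2 / b
        - real (nat \<lfloor>c * real n\<rfloor>) * (8 * b\<^sup>2 + b * repeat_frac k n / 4)
      \<le> expected_max k g n (nat \<lfloor>c * real n\<rfloor>)"
      unfolding m_def by linarith
  qed
qed

text \<open>The target is \<open>P Q (Q / k)\<close> under the root, so the general bound needs
  \<open>Q / k \<le> 1 / 4\<close>. This is clear for \<open>k \<ge> 4\<close>; for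
  \<open>k = 2, 3\<close> it follows from \<open>P \<ge> 2 / 2^k\<close>, when both values of
  \<open>g\<close> are taken at least twice. Otherwise some value is taken once, always so for
  \<open>k = 1\<close>; then \<open>P = 1 / 2^k\<close>, and \<open>Q^2 / k\<close> is largest at
  \<open>k = 2\<close>, where it is \<open>9/32 < 61/200\<close>.\<close>

lemma expected_max_lower_asymp:
  assumes k: "k \<ge> 1" and p: "p = avg (cube k) (\<lambda>z. of_bool (g z))" and p01: "0 < p" "p < 1"
    and P: "P = min p (1 - p)" and Q: "Q = 1 - P"
  shows "\<forall>\<^sub>F c :: real in at_top. \<forall>\<^sub>F n in sequentially.
    (p * c + sqrt (P * Q\<^sup>2 / k) * sqrt c) * n \<le> expected_max k g n (nat \<lfloor>c * real n\<rfloor>)"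
proof -
  define S where "S b = {z \<in> cube k. g z = b}" for b
  have finS: "finite (S b)" for b by (simp add: S_def)
  have "card (S True \<union> S False) = card (S True) + card (S False)"
    by (intro card_Un_disjoint finS) (auto simp: S_def)
  moreover have "S True \<union> S False = cube k" by (auto simp: S_def)
  ultimately have cards: "card (S True) + card (S False) = 2 ^ k" by (simp add: card_cube)
  have pS: "p = card (S True) / 2 ^ k"
    unfolding p avg_def S_def by (simp add: card_cube Int_def)
  have "real (card (S True)) + real (card (S False)) = 2 ^ k"
    using cards by (metis of_nat_add of_nat_numeral of_nat_power)
  then have qS: "1 - p = card (S False) / 2 ^ k" unfolding pS by (simp add: field_simps)
  have P0: "0 < P" "P \<le> 1 / 2" using p01 by (auto simp: P min_def)
  have PQ: "P * Q = p * (1 - p)" by (auto simp: P Q min_def)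
  have k2: "(2 :: real) ^ k \<ge> 2" using power_increasing[OF k, of "2 :: real"] by simp
  show ?thesis
  proof (cases "\<exists>b. card (S b) = 1")
    case True
    then obtain b z0 where z0: "S b = {z0}" by (auto simp: card_1_singleton_iff)
    then have z0': "z0 \<in> cube k" "\<And>z. z \<in> cube k \<Longrightarrow> (g z = b) = (z = z0)" by (auto simp: S_def)
    have "P = 1 / 2 ^ k"
    proof (cases b)
      case True
      then have "p = 1 / 2 ^ k" using z0 pS by simp
      moreover have "1 / 2 ^ k \<le> (1 / 2 :: real)" using k2 by (simp add: field_simps)
      ultimately show ?thesis by (simp add: P min_def)
    next
      case False
      then have "1 - p = 1 / 2 ^ k" using z0 qS by simp
      moreover have "1 / 2 ^ k \<le> (1 / 2 :: real)" using k2 by (simp add: field_simps)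
      ultimately have "1 - p \<le> p" by linarith
      then show ?thesis unfolding P \<open>1 - p = 1 / 2 ^ k\<close> by (simp add: min_def)
    qed
    have "Q\<^sup>2 / k < 61 / 200"
    proof -
      have Q_eq: "Q = 1 - 1 / 2 ^ k" using Q \<open>P = 1 / 2 ^ k\<close> by simp
      consider "k = 1" | "k = 2" | "k = 3" | "k \<ge> 4" using k by linarith
      then show ?thesis
      proof cases
        case 4
        have "Q\<^sup>2 \<le> 1" using P0 Q by (simp add: power_le_one)
        then have "Q\<^sup>2 / k \<le> 1 / 4" using 4 by (intro frac_le) auto
        then show ?thesis by linarith
      qed (simp_all add: Q_eq power2_eq_square)
    qed
    then have "P * (Q\<^sup>2 / k) < P * (61 / 200)" using P0 by (intro mult_strict_left_mono)
    with \<open>P = 1 / 2 ^ k\<close> have "P * Q\<^sup>2 / k < 61 / 200 * (1 / 2 ^ k)" by (simp only: mult.commute times_divide_eq_right)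
    then show ?thesis
      using P0 by (intro lower_asymp_singleton[OF k p z0']) auto
  next
    case False
    have "card (S b) \<noteq> 0" for b
    proof
      assume *: "card (S b) = 0"
      show False
      proof (cases b)
        case True
        then have "p = 0" unfolding pS using * by simp
        then show False using p01 by simp
      next
        case False
        then have "1 - p = 0" unfolding qS using * by simp
        then show False using p01 by simp
      qed
    qed
    with False have S2: "2 \<le> card (S b)" for b
      by (metis One_nat_def Suc_1 Suc_leI le_neq_implies_less less_one not_less)
    then have "2 / 2 ^ k \<le> p" "2 / 2 ^ k \<le> 1 - p"
      unfolding qS unfolding pS using S2[of True] S2[of False] by (auto intro!: divide_right_mono)
    then have P2: "2 / 2 ^ k \<le> P" by (simp add: P)
    have "k \<noteq> 1" using S2[of True] S2[of False] cards by auto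
    have "Q / k \<le> 1 / 4"
    proof -
      consider "k = 2" | "k = 3" | "k \<ge> 4" using k \<open>k \<noteq> 1\<close> by linarith
      then show ?thesis
      proof cases
        case 3
        then have "Q / k \<le> 1 / 4" using P0 Q by (intro frac_le) auto
        then show ?thesis .
      qed (use P2 Q in simp_all)
    qed
    then have "P * Q * (Q / k) \<le> P * Q * (1 / 4)"
      using P0 Q by (intro mult_left_mono) auto
    moreover have "P * Q\<^sup>2 / k = P * Q * (Q / k)" by (simp add: power2_eq_square)
    ultimately have "P * Q\<^sup>2 / k \<le> p * (1 - p) / 4" by (simp only: PQ)
    then show ?thesis
      using P0 p01 by (intro lower_asymp_general[OF p]) auto
  qed
qed

text \<open>For constantly true \<open>g\<close> the left side may exceed the number of clauses by
  the rounding, so the inequality can fail for every fixed \<open>n\<close> and only the quotient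
  tends to 1.\<close>

lemma asymp_le_floor:
  assumes "0 < c"
  shows "asymp_le (\<lambda>n. c * real n) (\<lambda>n. real (nat \<lfloor>c * real n\<rfloor>))"
proof -
  have "(\<lambda>n. c * real n / (c * real n - 1)) \<longlonglongrightarrow> 1"
    using assms by real_asymp
  then have lim: "(\<lambda>n. ereal (c * real n / (c * real n - 1))) \<longlonglongrightarrow> ereal 1" by simp
  have "limsup (\<lambda>n. ereal (c * real n) / ereal (real (nat \<lfloor>c * real n\<rfloor>)))
      \<le> limsup (\<lambda>n. ereal (c * real n / (c * real n - 1)))"
  proof (rule Limsup_mono)
    show "\<forall>\<^sub>F n in sequentially. ereal (c * real n) / ereal (real (nat \<lfloor>c * real n\<rfloor>))
        \<le> ereal (c * real n / (c * real n - 1))"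
      using eventually_ge_at_top[of "nat \<lceil>2 / c\<rceil>"]
    proof eventually_elim
      case (elim n)
      then have "2 / c \<le> n" by (simp add: nat_le_iff ceiling_le_iff)
      then have "2 \<le> c * n" using assms by (simp add: field_simps)
      moreover have "c * real n - 1 \<le> real (nat \<lfloor>c * real n\<rfloor>)" using calculation by linarith
      ultimately have "c * real n / real (nat \<lfloor>c * real n\<rfloor>) \<le> c * real n / (c * real n - 1)"
        by (intro divide_left_mono mult_pos_pos) auto
      moreover have "real (nat \<lfloor>c * real n\<rfloor>) \<noteq> 0" using \<open>2 \<le> c * n\<close> by linarith
      moreover have "ereal u / ereal v \<le> ereal w" if "u / v \<le> w" "v \<noteq> 0" for u v w
        using that by simp
      ultimately show ?case by blast
    qed
  qed
  also have "\<dots> = 1"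
    using lim_imp_Limsup[OF trivial_limit_sequentially lim] by (simp add: one_ereal_def)
  finally show ?thesis by (simp add: asymp_le_def)
qed

theorem theorem16:
  fixes k :: nat and g :: "bool list \<Rightarrow> bool" and p P Q :: real
  assumes "k \<ge> 1"
    and "p = measure_pmf.expectation (pmf_of_set (cube k)) (\<lambda>X. of_bool (g X))"
    and "P = min p (1 - p)"
    and "Q = 1 - P"
  shows "\<forall>\<^sub>F c :: real in at_top.
      asymp_le (\<lambda>n. (p * c + sqrt (P * Q\<^sup>2 * c / real k)) * real n)
               (\<lambda>n. expected_max k g n (nat \<lfloor>c * real n\<rfloor>)) \<and>
      asymp_le (\<lambda>n. expected_max k g n (nat \<lfloor>c * real n\<rfloor>))
               (\<lambda>n. (p * c + sqrt (2 * P * Q * ln 2 * c)) * real n)"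
proof -
  have p: "p = avg (cube k) (\<lambda>z. of_bool (g z))"
    unfolding assms(2) by (simp add: integral_pmf_of_set avg_def)
  have p01: "0 \<le> p" "p \<le> 1" unfolding p by (auto intro: avg_nonneg avg_le_const)
  have PQ: "P * Q = p * (1 - p)" by (auto simp: assms(3,4) min_def)
  show ?thesis
  \<comment> \<open>For constant \<open>g\<close> both square roots vanish, because
    \<open>P = 0\<close>.\<close>
  proof (cases "0 < p \<and> p < 1")
    case True
    then have P0: "0 < P" "P < 1" by (auto simp: assms(3))
    show ?thesis
      using expected_max_lower_asymp[OF assms(1) p conjunct1[OF True] conjunct2[OF True] assms(3,4)]
        expected_max_upper_asymp[OF assms(1) p conjunct1[OF True] conjunct2[OF True]]
        eventually_ge_at_top[of "0 :: real"]
    proof eventually_elim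
      case (elim c)
      have eq1: "sqrt (P * Q\<^sup>2 * c / real k) = sqrt (P * Q\<^sup>2 / real k) * sqrt c"
        by (simp add: real_sqrt_mult real_sqrt_divide)
      have eq2: "2 * P * Q * ln 2 * c = 2 * (p * (1 - p)) * ln 2 * c"
        by (simp add: PQ mult.assoc)
      show ?case
      proof
        show "asymp_le (\<lambda>n. (p * c + sqrt (P * Q\<^sup>2 * c / real k)) * real n)
               (\<lambda>n. expected_max k g n (nat \<lfloor>c * real n\<rfloor>))"
          unfolding eq1 using elim(1) by (intro asymp_leI) (use elim P0 p01 in \<open>auto elim!: eventually_mono\<close>)
        show "asymp_le (\<lambda>n. expected_max k g n (nat \<lfloor>c * real n\<rfloor>))
               (\<lambda>n. (p * c + sqrt (2 * P * Q * ln 2 * c)) * real n)"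
          unfolding eq2 using elim(2)
          by (intro asymp_leI) (auto elim!: eventually_mono simp: expected_max_nonneg)
      qed
    qed
  next
    case False
    then have "p = 0 \<or> p = 1" using p01 by auto
    then have P: "P = 0" "Q = 1" using assms by auto
    obtain b where b: "p = of_bool b" using \<open>p = 0 \<or> p = 1\<close> by (metis of_bool_eq)
    have g: "g z = b" if z: "z \<in> cube k" for z
    proof -
      have card: "real (card (cube k \<inter> Collect g)) = p * card (cube k)"
        using p by (simp add: avg_def)
      show ?thesis
      proof (cases b)
        case True
        then have "card (cube k \<inter> Collect g) = card (cube k)" using card b by simp
        then have "cube k \<inter> Collect g = cube k" by (intro card_subset_eq) auto
        then show ?thesis using True z by auto
      next
        case False
        then have "cube k \<inter> Collect g = {}" using card b by simp
        then show ?thesis using False z by auto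
      qed
    qed
    show ?thesis
      using eventually_gt_at_top[of 0]
    proof eventually_elim
      case (elim c)
      have ev: "\<forall>\<^sub>F n in sequentially. expected_max k g n (nat \<lfloor>c * real n\<rfloor>) = p * real (nat \<lfloor>c * real n\<rfloor>)"
        using eventually_ge_at_top[of k] by eventually_elim (simp add: expected_max_constant[of k _ g b] g b)
      show ?case
      proof
        have "asymp_le (\<lambda>n. p * (c * real n)) (\<lambda>n. p * real (nat \<lfloor>c * real n\<rfloor>))"
          using asymp_le_floor[OF elim] b by (cases b) (auto intro: asymp_leI)
        then show "asymp_le (\<lambda>n. (p * c + sqrt (P * Q\<^sup>2 * c / real k)) * real n)
               (\<lambda>n. expected_max k g n (nat \<lfloor>c * real n\<rfloor>))"
          unfolding asymp_le_def P using ev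
          by (subst Limsup_eq[where g = "\<lambda>n. ereal (p * (c * real n)) / ereal (p * real (nat \<lfloor>c * real n\<rfloor>))"])
            (auto elim!: eventually_mono simp: mult_ac)
        show "asymp_le (\<lambda>n. expected_max k g n (nat \<lfloor>c * real n\<rfloor>))
               (\<lambda>n. (p * c + sqrt (2 * P * Q * ln 2 * c)) * real n)"
        proof (rule asymp_leI, use ev in eventually_elim)
          case (elim n)
          have "p * real (nat \<lfloor>c * real n\<rfloor>) \<le> p * (c * real n)"
            using p01 \<open>0 < c\<close> by (intro mult_left_mono) auto
          then show ?case using elim p01 P by (simp add: mult.assoc)
        qed
      qed
    qed
  qed
qed

end
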